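(* Consider the uncertain closed-loop system $x(t+1)=A_dx(t)+B_d\pi(x(t))$ with $A_d\in[\underline A_d,\overline A_d]\subset\mathbb R^{n\times n}$, $B_d\in[\underline B_d,\overline B_d]\subset\mathbb R^{n\times m}$, where $\pi$ is the given $\ell$-layer feedforward network with $\pi(0)=0$. Let $x_*=0$, $u_*=0$, and let $v_*,w_*\in\mathbb R^{n_\phi}$ be the corresponding equilibrium activation inputs and outputs. Let $\overline v^1\in\mathbb R^{n_1}$, and let $\alpha_\phi\le\beta_\phi$ in $\mathbb R^{n_\phi}$ be given. With $\hat n=2n+n_\phi$ and $D$, $Z(\lambda,P)$, $U$, $V$ as defined in the context, the following two statements are equivalent. a) There exist a symmetric positive definite matrix $P\in\mathbb R^{n\times n}$, a vector $\lambda\in\mathbb R^{n_\phi}_{\ge0}$, and scalars $\gamma_{ij}>0$ ($1\le i\le\hat n$, $1\le j\le n$) such that $$\begin{bmatrix}Z(\lambda,P)+\sum_{i=1}^{\hat n}\sum_{j=1}^n\gamma_{ij}(D(i,j))^2e_ie_i^\top&U\\ *&-V\end{bmatrix}\prec0$$ and $$\begin{bmatrix}(\overline v_i^1-v_{*,i}^1)^2&W_i^1\\(W_i^1)^\top&P\end{bmatrix}\succeq0\quad\text{for all }i\in\{1,\dots,n_1\}.$$ b) There exist a symmetric positive definite matrix $P\in\mathbb R^{n\times n}$, a vector $\lambda\in\mathbb R^{n_\phi}_{\ge0}$, and diagonal matrices $T\in\mathbb R^{\hat n\times\hat n}$, $S\in\mathbb R^{n\times n}$ such that $$\begin{bmatrix}Z(\lambda,P)+T&*\\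 \begin{bmatrix}0_{n\times(n+n_\phi)}&P\end{bmatrix}&-S\end{bmatrix}\prec0,\qquad DSD^\top\prec T,$$ and $$\begin{bmatrix}(\overline v_i^1-v_{*,i}^1)^2&W_i^1\\(W_i^1)^\top&P\end{bmatrix}\succeq0\quad\text{for all }i\in\{1,\dots,n_1\}.$$
   Context: Inequalities $\le,\ge$ between vectors or matrices are entrywise; $\prec,\preceq,\succ,\succeq$ refer to definiteness of symmetric matrices; $*$ denotes a block determined by symmetry. For $\underline A\le\overline A$, $[\underline A,\overline A]$ is the set of matrices $A$ with $\underline A(i,j)\le A(i,j)\le\overline A(i,j)$ for all $i,j$. Network: $\pi:\mathbb R^n\to\mathbb R^m$ is given by $w^0=x$, $v^i=W^iw^{i-1}+b^i$, $w^i=\phi^i(v^i)$ for $i=1,\dots,\ell$, $\pi(x)=W^{\ell+1}w^\ell+b^{\ell+1}$, with $n_0=n$, $W^i\in\mathbb R^{n_i\times n_{i-1}}$, $b^i\in\mathbb R^{n_i}$ for $i\le\ell$, $W^{\ell+1}\in\mathbb R^{m\times n_\ell}$, $b^{\ell+1}\in\mathbb R^m$, and $\phi^i$ applying a scalar activation function $\varphi:\mathbb R\to\mathbb R$ entrywise. It is assumed that $\pi(0)=0$. Let $n_\phi=\sum_{i=1}^\ell n_i$, let $v_\phi,w_\phi\in\mathbb R^{n_\phi}$ be the stacked vectors $(v^1,\dots,v^\ell)$, $(w^1,\dots,w^\ell)$. The vectors $v_*=(v_*^1,\dots,v_*^\ell)$ and $w_*$ are the values of $v_\phi,w_\phi$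 at input $x=0$; $v_{*,i}^1$ and $\overline v_i^1$ are the $i$-th entries of $v_*^1$ and $\overline v^1$, and $W_i^1$ is the $i$-th row of $W^1$. The matrices $N_{vx},N_{vw},N_{ux},N_{uw}$ are defined by writing $v_\phi=N_{vx}x+N_{vw}w_\phi+N_{vb}$ and $u=\pi(x)=N_{ux}x+N_{uw}w_\phi+N_{ub}$: $N_{vx}\in\mathbb R^{n_\phi\times n}$ has first block row $W^1$ and all other block rows zero; $N_{vw}\in\mathbb R^{n_\phi\times n_\phi}$ has block $W^{i}$ in block position $(i,i-1)$ for $i=2,\dots,\ell$ and zeros elsewhere; $N_{ux}=0_{m\times n}$; $N_{uw}=[0\ \cdots\ 0\ W^{\ell+1}]\in\mathbb R^{m\times n_\phi}$. Matrices: $$R_V=\begin{bmatrix}I_n&0_{n\times n_\phi}\\N_{ux}&N_{uw}\end{bmatrix},\quad R_\phi=\begin{bmatrix}N_{vx}&N_{vw}\\0_{n_\phi\times n}&I_{n_\phi}\end{bmatrix},\quad \Psi_\phi=\begin{bmatrix}\operatorname{diag}(\beta_\phi)&-I_{n_\phi}\\-\operatorname{diag}(\alpha_\phi)&I_{n_\phi}\end{bmatrix},$$ $$M_\phi(\lambda)=\begin{bmatrix}0&\operatorname{diag}(\lambda)\\\operatorname{diag}(\lambda)&0\end{bmatrix},\quad X(\lambda)=R_\phi^\top\Psi_\phi^\top M_\phi(\lambda)\Psi_\phi R_\phi.$$ Let $A_0=\frac12(\overline A_d+\underline A_d)$, $A_r=\frac12(\overline A_d-\underline A_d)$. Let $\underline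 B_N,\overline B_N\in\mathbb R^{n\times n_\phi}$ be the entrywise infimum and supremum of $B_dN_{uw}$ over $B_d\in[\underline B_d,\overline B_d]$, and $\tilde B_0=\frac12(\overline B_N+\underline B_N)$, $\tilde B_r=\frac12(\overline B_N-\underline B_N)$. Put $D=[A_r\ \ \tilde B_r\ \ 0_{n\times n}]^\top\in\mathbb R^{\hat n\times n}$, let $e_i\in\mathbb R^{\hat n}$ be the $i$-th standard basis vector, and $$Z(\lambda,P)=\begin{bmatrix}-R_V^\top\begin{bmatrix}I_n\\0_{m\times n}\end{bmatrix}P\begin{bmatrix}I_n&0_{n\times m}\end{bmatrix}R_V+X(\lambda)&*\\P\begin{bmatrix}A_0&\tilde B_0\end{bmatrix}&-P\end{bmatrix}\in\mathbb R^{\hat n\times\hat n}.$$ For scalars $\gamma_{ij}$, $V=\operatorname{diag}(\gamma_{11},\dots,\gamma_{1n},\dots,\gamma_{\hat n1},\dots,\gamma_{\hat nn})$ and $$U=\begin{bmatrix}0_{(n+n_\phi)\times n}&\cdots&0_{(n+n_\phi)\times n}\\P&\cdots&P\end{bmatrix}\in\mathbb R^{\hat n\times\hat nn}\quad(\hat n\text{ block columns}).$$ *)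

theory Defs
  imports Complex_Main "Jordan_Normal_Form.Matrix"
begin

definition pos_def :: "real mat \<Rightarrow> bool" where
  "pos_def A \<longleftrightarrow> square_mat A \<and> transpose_mat A = A \<and>
    (\<forall>x \<in> carrier_vec (dim_row A). x \<noteq> 0\<^sub>v (dim_row A) \<longrightarrow> x \<bullet> (A *\<^sub>v x) > 0)"

definition pos_semidef :: "real mat \<Rightarrow> bool" where
  "pos_semidef A \<longleftrightarrow> square_mat A \<and> transpose_mat A = A \<and>
    (\<forall>x \<in> carrier_vec (dim_row A). x \<bullet> (A *\<^sub>v x) \<ge> 0)"

(* The class order on matrices is the entrywise one, so the definiteness order on
   symmetric matrices gets its own symbols. *)

definition loewner_less :: "real mat \<Rightarrow> real mat \<Rightarrow> bool" (infix \<open>\<prec>\<^sub>m\<close> 50) where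
  "A \<prec>\<^sub>m B \<longleftrightarrow> dim_row A = dim_row B \<and> dim_col A = dim_col B \<and>
    transpose_mat A = A \<and> transpose_mat B = B \<and> pos_def (B - A)"

definition loewner_le :: "real mat \<Rightarrow> real mat \<Rightarrow> bool" (infix \<open>\<preceq>\<^sub>m\<close> 50) where
  "A \<preceq>\<^sub>m B \<longleftrightarrow> dim_row A = dim_row B \<and> dim_col A = dim_col B \<and>
    transpose_mat A = A \<and> transpose_mat B = B \<and> pos_semidef (B - A)"

definition append_cols :: "'a::zero mat \<Rightarrow> 'a mat \<Rightarrow> 'a mat" (infixr \<open>@\<^sub>c\<close> 65) where
  "A @\<^sub>c B = four_block_mat A B (0\<^sub>m 0 (dim_col A)) (0\<^sub>m 0 (dim_col B))"

definition diag_of_vec :: "'a::zero vec \<Rightarrow> 'a mat" where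
  "diag_of_vec v = mat_diag (dim_vec v) (\<lambda>i. v $ i)"

definition outer_prod :: "'a::times vec \<Rightarrow> 'a vec \<Rightarrow> 'a mat" where
  "outer_prod u v = mat (dim_vec u) (dim_vec v) (\<lambda>(i, j). u $ i * v $ j)"

(* Matrices of varying dimension have no 0, so sum is not available for them. *)

definition sum_of_mats :: "nat \<Rightarrow> nat \<Rightarrow> ('k \<Rightarrow> 'a::comm_monoid_add mat) \<Rightarrow> 'k set \<Rightarrow> 'a mat" where
  "sum_of_mats nr nc F K = mat nr nc (\<lambda>ij. \<Sum>k\<in>K. F k $$ ij)"

(* Feedforward networks. Layers are numbered from 1; the weights W i and biases b i are
   used for i = 1, ..., l + 1, and width 0 is the input dimension. *)

fun layer_out :: "(real \<Rightarrow> real) \<Rightarrow> (nat \<Rightarrow> real mat) \<Rightarrow> (nat \<Rightarrow> real vec) \<Rightarrow> real vec \<Rightarrow> nat \<Rightarrow> real vec"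
where
  "layer_out \<phi> W b x 0 = x"
| "layer_out \<phi> W b x (Suc i) = map_vec \<phi> (W (Suc i) *\<^sub>v layer_out \<phi> W b x i + b (Suc i))"

definition layer_in :: "(real \<Rightarrow> real) \<Rightarrow> (nat \<Rightarrow> real mat) \<Rightarrow> (nat \<Rightarrow> real vec) \<Rightarrow> real vec \<Rightarrow> nat \<Rightarrow> real vec"
where
  "layer_in \<phi> W b x i = W i *\<^sub>v layer_out \<phi> W b x (i - 1) + b i"

definition network :: "(real \<Rightarrow> real) \<Rightarrow> (nat \<Rightarrow> real mat) \<Rightarrow> (nat \<Rightarrow> real vec) \<Rightarrow> nat \<Rightarrow> real vec \<Rightarrow> real vec"
where
  "network \<phi> W b l x = W (l + 1) *\<^sub>v layer_out \<phi> W b x l + b (l + 1)"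

fun stack_vec :: "(nat \<Rightarrow> 'a vec) \<Rightarrow> nat \<Rightarrow> 'a vec" where
  "stack_vec f 0 = vNil"
| "stack_vec f (Suc k) = stack_vec f k @\<^sub>v f (Suc k)"

definition N_vx :: "(nat \<Rightarrow> nat) \<Rightarrow> (nat \<Rightarrow> real mat) \<Rightarrow> nat \<Rightarrow> real mat" where
  "N_vx width W l = W 1 @\<^sub>r 0\<^sub>m (\<Sum>i=2..l. width i) (width 0)"

(* Adding one layer appends the block row [0 ... 0 W] and a zero block column. *)

fun N_vw :: "(nat \<Rightarrow> nat) \<Rightarrow> (nat \<Rightarrow> real mat) \<Rightarrow> nat \<Rightarrow> real mat" where
  "N_vw width W 0 = 0\<^sub>m 0 0"
| "N_vw width W (Suc 0) = 0\<^sub>m (width 1) (width 1)"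
| "N_vw width W (Suc (Suc k)) = four_block_mat
     (N_vw width W (Suc k))
     (0\<^sub>m (\<Sum>i=1..Suc k. width i) (width (Suc (Suc k))))
     (0\<^sub>m (width (Suc (Suc k))) (\<Sum>i=1..k. width i) @\<^sub>c W (Suc (Suc k)))
     (0\<^sub>m (width (Suc (Suc k))) (width (Suc (Suc k))))"

definition N_uw :: "(nat \<Rightarrow> nat) \<Rightarrow> (nat \<Rightarrow> real mat) \<Rightarrow> nat \<Rightarrow> real mat" where
  "N_uw width W l = 0\<^sub>m (width (l + 1)) (\<Sum>i=1..l-1. width i) @\<^sub>c W (l + 1)"

(* The matrices above realise v_phi = N_vx x + N_vw w_phi + N_vb and
   \<pi>(x) = N_ux x + N_uw w_phi + N_ub with N_ux = 0, N_ub = b (l + 1). *)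

lemma append_cols_mult_vec:
  fixes A B :: "'a::semiring_1 mat"
  assumes A: "A \<in> carrier_mat nr nc1" and B: "B \<in> carrier_mat nr nc2"
    and x: "x \<in> carrier_vec nc1" and y: "y \<in> carrier_vec nc2"
  shows "(A @\<^sub>c B) *\<^sub>v (x @\<^sub>v y) = A *\<^sub>v x + B *\<^sub>v y"
proof -
  have "(A @\<^sub>c B) *\<^sub>v (x @\<^sub>v y)
      = (A *\<^sub>v x + B *\<^sub>v y) @\<^sub>v (0\<^sub>m 0 nc1 *\<^sub>v x + 0\<^sub>m 0 nc2 *\<^sub>v y)"
    unfolding append_cols_def using A B
    by (subst four_block_mat_mult_vec[OF A B _ _ x y]) auto
  also have "\<dots> = A *\<^sub>v x + B *\<^sub>v y"
    by (intro eq_vecI) auto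
  finally show ?thesis .
qed

lemma append_cols_carrier:
  "A \<in> carrier_mat nr nc1 \<Longrightarrow> B \<in> carrier_mat nr nc2 \<Longrightarrow> A @\<^sub>c B \<in> carrier_mat nr (nc1 + nc2)"
  unfolding append_cols_def by auto

lemma stack_vec_carrier:
  assumes "\<And>i. i \<in> {1..k} \<Longrightarrow> f i \<in> carrier_vec (width i)"
  shows "stack_vec f k \<in> carrier_vec (\<Sum>i=1..k. width i)"
  using assms
proof (induction k)
  case (Suc k)
  then have "stack_vec f k \<in> carrier_vec (\<Sum>i=1..k. width i)" "f (Suc k) \<in> carrier_vec (width (Suc k))"
    by auto
  then show ?case by (auto intro!: append_carrier_vec)
qed auto

lemma layer_out_carrier:
  assumes "\<And>i. i \<in> {1..k} \<Longrightarrow> W i \<in> carrier_mat (width i) (width (i - 1))"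
    and "\<And>i. i \<in> {1..k} \<Longrightarrow> b i \<in> carrier_vec (width i)"
    and "x \<in> carrier_vec (width 0)"
  shows "layer_out \<phi> W b x k \<in> carrier_vec (width k)"
  using assms
proof (cases k)
  case (Suc j)
  then have "W (Suc j) \<in> carrier_mat (width (Suc j)) (width j)" "b (Suc j) \<in> carrier_vec (width (Suc j))"
    using assms(1)[of "Suc j"] assms(2)[of "Suc j"] by auto
  with Suc show ?thesis by (auto intro!: carrier_vecI)
qed auto

lemma N_vx_carrier:
  assumes "l \<ge> 1" "W 1 \<in> carrier_mat (width 1) (width 0)"
  shows "N_vx width W l \<in> carrier_mat (\<Sum>i=1..l. width i) (width 0)"
proof -
  have "(\<Sum>i=1..l. width i) = width 1 + (\<Sum>i=2..l. width i)"
    using assms(1) by (simp add: sum.atLeast_Suc_atMost numeral_2_eq_2)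
  with assms(2) show ?thesis by (auto simp: N_vx_def)
qed

lemma N_vw_carrier:
  assumes "\<And>i. i \<in> {1..l} \<Longrightarrow> W i \<in> carrier_mat (width i) (width (i - 1))"
  shows "N_vw width W l \<in> carrier_mat (\<Sum>i=1..l. width i) (\<Sum>i=1..l. width i)"
  using assms
proof (induction width W l rule: N_vw.induct)
  case (3 width W k)
  then have "N_vw width W (Suc k) \<in> carrier_mat (\<Sum>i=1..Suc k. width i) (\<Sum>i=1..Suc k. width i)"
    by auto
  then show ?case by auto
qed auto

lemma N_uw_carrier:
  assumes "l \<ge> 1" "W (l + 1) \<in> carrier_mat (width (l + 1)) (width l)"
  shows "N_uw width W l \<in> carrier_mat (width (l + 1)) (\<Sum>i=1..l. width i)"
proof -
  obtain k where k: "l = Suc k" using assms(1) by (cases l) auto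
  have "0\<^sub>m (width (l + 1)) (\<Sum>i=1..k. width i) @\<^sub>c W (l + 1)
      \<in> carrier_mat (width (l + 1)) ((\<Sum>i=1..k. width i) + width l)"
    by (rule append_cols_carrier) (use assms(2) in auto)
  then show ?thesis by (simp add: N_uw_def k)
qed

lemma stacked_layer_in:
  assumes "l \<ge> 1"
    and "\<And>i. i \<in> {1..l} \<Longrightarrow> W i \<in> carrier_mat (width i) (width (i - 1))"
    and "\<And>i. i \<in> {1..l} \<Longrightarrow> b i \<in> carrier_vec (width i)"
    and x: "x \<in> carrier_vec (width 0)"
  shows "stack_vec (layer_in \<phi> W b x) l =
    N_vx width W l *\<^sub>v x + N_vw width W l *\<^sub>v stack_vec (layer_out \<phi> W b x) l + stack_vec b l"
  using assms(1-3)
proof (induction l rule: dec_induct)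
  case base
  have W: "W (Suc 0) \<in> carrier_mat (width (Suc 0)) (width 0)" and b: "b (Suc 0) \<in> carrier_vec (width (Suc 0))"
    using base(1)[of 1] base(2)[of 1] by auto
  have c: "layer_out \<phi> W b x (Suc 0) \<in> carrier_vec (width (Suc 0))" using W b by (auto intro!: carrier_vecI)
  have nil: "vNil @\<^sub>v v = v" for v :: "real vec" by (intro eq_vecI) auto
  have Nvx: "N_vx width W (Suc 0) *\<^sub>v x = W (Suc 0) *\<^sub>v x @\<^sub>v 0\<^sub>m 0 (width 0) *\<^sub>v x"
    unfolding N_vx_def by (simp, rule mat_mult_append[OF W _ x]) auto
  have "W (Suc 0) *\<^sub>v x @\<^sub>v 0\<^sub>m 0 (width 0) *\<^sub>v x = W (Suc 0) *\<^sub>v x"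
    by (intro eq_vecI) auto
  moreover have "0\<^sub>m (width (Suc 0)) (width (Suc 0)) *\<^sub>v layer_out \<phi> W b x (Suc 0) = 0\<^sub>v (width (Suc 0))"
    using c by auto
  ultimately show ?case
    using W b x Nvx by (simp add: nil layer_in_def del: layer_out.simps(2))
next
  case (step l)
  let ?s = "\<lambda>k. \<Sum>i=1..k. width i"
  let ?o = "layer_out \<phi> W b x"
  obtain k where k: "l = Suc k" using step(1) by (cases l) auto
  have W: "W i \<in> carrier_mat (width i) (width (i - 1))" and b: "b i \<in> carrier_vec (width i)"
    if "i \<in> {1..Suc l}" for i using step(4)[OF that] step(5)[OF that] .
  have o: "?o i \<in> carrier_vec (width i)" if "i \<le> Suc l" for i
    by (rule layer_out_carrier) (use that W b x in auto)
  have W': "W (Suc l) \<in> carrier_mat (width (Suc l)) (width l)" using W[of "Suc l"] by simp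
  have b': "b (Suc l) \<in> carrier_vec (width (Suc l))" using b[of "Suc l"] by simp
  have so: "stack_vec ?o j \<in> carrier_vec (?s j)" if "j \<le> Suc l" for j
    by (rule stack_vec_carrier) (use that o in auto)
  have sb: "stack_vec b l \<in> carrier_vec (?s l)" by (rule stack_vec_carrier) (use b in auto)
  have Nvx: "N_vx width W l \<in> carrier_mat (?s l) (width 0)"
    by (rule N_vx_carrier) (use step(1) W[of 1] in auto)
  have Nvw: "N_vw width W l \<in> carrier_mat (?s l) (?s l)"
    by (rule N_vw_carrier) (use W in auto)
  have IH: "stack_vec (layer_in \<phi> W b x) l =
      N_vx width W l *\<^sub>v x + N_vw width W l *\<^sub>v stack_vec ?o l + stack_vec b l"
    by (rule step(3)) (use W b in auto)
  have "N_vx width W (Suc l) = N_vx width W l @\<^sub>r 0\<^sub>m (width (Suc l)) (width 0)"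
    using step(1) W[of 1] unfolding N_vx_def append_rows_def
    by (intro eq_matI) auto
  then have X: "N_vx width W (Suc l) *\<^sub>v x = N_vx width W l *\<^sub>v x @\<^sub>v 0\<^sub>v (width (Suc l))"
    using mat_mult_append[OF Nvx _ x, of "0\<^sub>m (width (Suc l)) (width 0)" "width (Suc l)"] x by auto
  let ?C = "0\<^sub>m (width (Suc l)) (?s k) @\<^sub>c W (Suc l)"
  have C: "?C \<in> carrier_mat (width (Suc l)) (?s l)"
    using append_cols_carrier[OF zero_carrier_mat W', of "?s k"] by (simp add: k)
  have "N_vw width W (Suc l) *\<^sub>v stack_vec ?o (Suc l)
      = (N_vw width W l *\<^sub>v stack_vec ?o l + 0\<^sub>m (?s l) (width (Suc l)) *\<^sub>v ?o (Suc l))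
        @\<^sub>v (?C *\<^sub>v stack_vec ?o l + 0\<^sub>m (width (Suc l)) (width (Suc l)) *\<^sub>v ?o (Suc l))"
    using four_block_mat_mult_vec[OF Nvw _ C _ so o, of "0\<^sub>m (?s l) (width (Suc l))" "Suc l"
        "0\<^sub>m (width (Suc l)) (width (Suc l))"]
    by (simp add: k del: layer_out.simps)
  also have "0\<^sub>m (?s l) (width (Suc l)) *\<^sub>v ?o (Suc l) = 0\<^sub>v (?s l)" using o[of "Suc l"] by auto
  also have "0\<^sub>m (width (Suc l)) (width (Suc l)) *\<^sub>v ?o (Suc l) = 0\<^sub>v (width (Suc l))"
    using o[of "Suc l"] by auto
  also have "?C *\<^sub>v stack_vec ?o l
      = 0\<^sub>m (width (Suc l)) (?s k) *\<^sub>v stack_vec ?o k + W (Suc l) *\<^sub>v ?o l"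
    using append_cols_mult_vec[OF zero_carrier_mat W' so o, of k] k by (simp del: layer_out.simps)
  also have "0\<^sub>m (width (Suc l)) (?s k) *\<^sub>v stack_vec ?o k = 0\<^sub>v (width (Suc l))"
    using so[of k] k by auto
  finally have Y: "N_vw width W (Suc l) *\<^sub>v stack_vec ?o (Suc l)
      = N_vw width W l *\<^sub>v stack_vec ?o l @\<^sub>v W (Suc l) *\<^sub>v ?o l"
    using Nvw so[of l] W' by auto
  have "stack_vec (layer_in \<phi> W b x) (Suc l)
      = (N_vx width W l *\<^sub>v x + N_vw width W l *\<^sub>v stack_vec ?o l + stack_vec b l)
        @\<^sub>v (W (Suc l) *\<^sub>v ?o l + b (Suc l))"
    by (simp add: IH layer_in_def)
  also have "\<dots> = N_vx width W (Suc l) *\<^sub>v x + N_vw width W (Suc l) *\<^sub>v stack_vec ?o (Suc l)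
      + stack_vec b (Suc l)"
    unfolding X Y unfolding stack_vec.simps using Nvx Nvw sb W' b' so[of l] x
    by (intro eq_vecI) (auto simp del: layer_out.simps)
  finally show ?case .
qed

lemma network_stacked:
  assumes "l \<ge> 1"
    and "\<And>i. i \<in> {1..l + 1} \<Longrightarrow> W i \<in> carrier_mat (width i) (width (i - 1))"
    and "\<And>i. i \<in> {1..l + 1} \<Longrightarrow> b i \<in> carrier_vec (width i)"
    and "x \<in> carrier_vec (width 0)"
  shows "network \<phi> W b l x = N_uw width W l *\<^sub>v stack_vec (layer_out \<phi> W b x) l + b (l + 1)"
proof -
  let ?o = "layer_out \<phi> W b x"
  obtain k where k: "l = Suc k" using assms(1) by (cases l) auto
  have o: "?o i \<in> carrier_vec (width i)" if "i \<le> l" for i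
    by (rule layer_out_carrier) (use that assms in auto)
  have so: "stack_vec ?o k \<in> carrier_vec (\<Sum>i=1..k. width i)"
    by (rule stack_vec_carrier) (use o k in auto)
  have W: "W (l + 1) \<in> carrier_mat (width (l + 1)) (width l)" using assms(2)[of "l + 1"] by simp
  have "N_uw width W l *\<^sub>v stack_vec ?o l
      = 0\<^sub>m (width (l + 1)) (\<Sum>i=1..k. width i) *\<^sub>v stack_vec ?o k + W (l + 1) *\<^sub>v ?o l"
    unfolding N_uw_def using append_cols_mult_vec[OF zero_carrier_mat W so o]
    by (simp add: k del: layer_out.simps)
  also have "\<dots> = W (l + 1) *\<^sub>v ?o l"
    using so W by (intro eq_vecI) auto
  finally show ?thesis by (simp add: network_def)
qed

end

theory Submission
  imports Defs "Jordan_Normal_Form.Determinant"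
begin

text \<open>
  Both statements ask for the same \<open>P\<close> and \<open>\<lambda>\<close> and share the conditions on them alone, so \<open>P\<close> and \<open>\<lambda>\<close>
  may be fixed, and it is the existence of the remaining multipliers that has to be compared.
  \<open>Z = Z(\<lambda>, P)\<close> enters both matrix inequalities in the same way, \<open>U\<close> repeats the transpose of
  \<open>C = [0  P]\<close>, and \<open>D\<close> is entrywise non-negative, because it collects radii of intervals.

  Eliminating the diagonal lower right blocks by Schur complements turns the two matrix inequalities
  into \<open>Z + diag(\<Sum>\<^sub>j \<gamma>\<^sub>i\<^sub>j D\<^sub>i\<^sub>j\<^sup>2) + C\<^sup>T diag(\<Sum>\<^sub>i 1/\<gamma>\<^sub>i\<^sub>j) C \<prec> 0\<close> and \<open>Z + T + C\<^sup>T S\<^sup>-\<^sup>1 C \<prec> 0\<close>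
  (\<open>neg_def_repeated_block_iff\<close>, \<open>neg_def_block_diag_iff\<close>). The first complement is thus an instance
  of the second with \<open>T\<^sub>i\<^sub>i = \<Sum>\<^sub>j \<gamma>\<^sub>i\<^sub>j D\<^sub>i\<^sub>j\<^sup>2\<close> and \<open>1/S\<^sub>j\<^sub>j = \<Sum>\<^sub>i 1/\<gamma>\<^sub>i\<^sub>j\<close>, and for these values weighted
  Cauchy-Schwarz gives \<open>D S D\<^sup>T \<preceq> T\<close>. Strictness comes from adding a small multiple of the identity
  to \<open>T\<close>, for which a negative definite matrix has room (\<open>pos_def_coercive\<close>).

  The converse is the point of the theorem: whenever \<open>D S D\<^sup>T \<prec> T\<close>, there are weights \<open>\<gamma>\<close> whose \<open>T\<close> and
  \<open>S\<^sup>-\<^sup>1\<close> are at most the given ones. Since \<open>D \<ge> 0\<close> and \<open>T\<close> is diagonal, \<open>T - D S D\<^sup>T\<close> is positive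
  definite with non-positive off-diagonal entries, so some \<open>x > 0\<close> satisfies \<open>D S D\<^sup>T x < T x\<close> entrywise
  (\<open>pos_def_Z_matrix_pos_vec\<close>). From \<open>x\<close> the weights are \<open>\<gamma>\<^sub>i\<^sub>j = S\<^sub>j\<^sub>j (D\<^sup>T x)\<^sub>j / (D\<^sub>i\<^sub>j x\<^sub>i)\<close>, after a
  perturbation that makes all \<open>D\<^sub>i\<^sub>j\<close> positive (\<open>exists_pos_weights\<close>).
\<close>

section \<open>Positive definite matrices\<close>

lemma loewner_less_iff:
  assumes "A \<in> carrier_mat N N" "B \<in> carrier_mat N N"
  shows "A \<prec>\<^sub>m B \<longleftrightarrow> transpose_mat A = A \<and> transpose_mat B = B \<and>
    (\<forall>x \<in> carrier_vec N. x \<noteq> 0\<^sub>v N \<longrightarrow> x \<bullet> (A *\<^sub>v x) < x \<bullet> (B *\<^sub>v x))"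
proof -
  have q: "x \<bullet> ((B - A) *\<^sub>v x) = x \<bullet> (B *\<^sub>v x) - x \<bullet> (A *\<^sub>v x)" if x: "x \<in> carrier_vec N" for x
    using assms x
    by (simp add: minus_mult_distrib_mat_vec[of _ N N] scalar_prod_minus_distrib[of _ N])
  have t: "transpose_mat (B - A) = transpose_mat B - transpose_mat A"
    using assms by (intro eq_matI) auto
  show ?thesis
    using assms by (auto simp: loewner_less_def pos_def_def t q)
qed

lemma scalar_prod_self_pos:
  fixes x :: "real vec"
  assumes "x \<in> carrier_vec N" "x \<noteq> 0\<^sub>v N"
  shows "0 < x \<bullet> x"
proof -
  obtain i where "i < N" "x $ i \<noteq> 0"
    using assms by (metis carrier_vecD eq_vecI index_zero_vec)
  then show ?thesis
    using assms unfolding scalar_prod_def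
    by (intro sum_pos2[of _ i]) (auto simp: zero_less_mult_iff linorder_neq_iff)
qed

lemma pos_def_solve:
  assumes Q: "pos_def Q" "Q \<in> carrier_mat N N" and b: "b \<in> carrier_vec N"
  obtains y where "y \<in> carrier_vec N" "Q *\<^sub>v y = b"
proof -
  have "det Q \<noteq> 0"
    using Q by (force simp: det_0_iff_vec_prod_zero_field[OF Q(2)] pos_def_def)
  from det_non_zero_imp_unit[OF Q(2) this, of "()"]
  obtain R where R: "R \<in> carrier_mat N N" "Q * R = 1\<^sub>m N"
    unfolding Units_def ring_mat_def by auto
  have "Q *\<^sub>v (R *\<^sub>v b) = b"
    using assoc_mult_mat_vec[OF Q(2) R(1) b] R b by simp
  with R b that[of "R *\<^sub>v b"] show thesis by simp
qed

text \<open>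
  This uniform bound replaces compactness of the unit sphere. If \<open>Q *\<^sub>v y = e\<^sub>i\<close>, then
  non-negativity of the form at \<open>x - t y\<close> for the optimal \<open>t\<close> bounds \<open>x\<^sub>i\<^sup>2\<close> by a multiple of the form at
  \<open>x\<close>; summing over \<open>i\<close> bounds \<open>x \<bullet> x\<close>. It supplies the slack that keeps strict matrix inequalities
  strict under small perturbations.
\<close>

lemma pos_def_coercive:
  assumes Q: "pos_def Q" "Q \<in> carrier_mat N N"
  shows "\<exists>\<epsilon>>0. \<forall>x\<in>carrier_vec N. \<epsilon> * (x \<bullet> x) \<le> x \<bullet> (Q *\<^sub>v x)"
proof -
  have sym: "transpose_mat Q = Q" using Q by (simp add: pos_def_def)
  have nonneg: "0 \<le> x \<bullet> (Q *\<^sub>v x)" if "x \<in> carrier_vec N" for x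
    using Q that by (cases "x = 0\<^sub>v N") (auto simp: pos_def_def less_imp_le)
  have "\<exists>y. y \<in> carrier_vec N \<and> Q *\<^sub>v y = unit_vec N i" for i
    using pos_def_solve[OF Q unit_vec_carrier] by blast
  then obtain y where y: "\<And>i. y i \<in> carrier_vec N" "\<And>i. Q *\<^sub>v y i = unit_vec N i"
    by metis
  have coord: "(x $ i)\<^sup>2 \<le> x \<bullet> (Q *\<^sub>v x) * y i $ i" and yi: "0 < y i $ i"
    if x: "x \<in> carrier_vec N" and i: "i < N" for x i
  proof -
    have "y i \<bullet> (Q *\<^sub>v y i) = y i $ i" using y i by simp
    moreover have "y i \<noteq> 0\<^sub>v N"
    proof
      assume "y i = 0\<^sub>v N"
      moreover have "(Q *\<^sub>v 0\<^sub>v N) $ i = 0" using Q(2) i by simp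
      ultimately have "unit_vec N i $ i = (0::real)" using y(2)[of i] by simp
      then show False using i by simp
    qed
    ultimately show pos: "0 < y i $ i" using Q y(1)[of i] by (auto simp: pos_def_def)
    \<comment> \<open>The minimiser over \<open>t\<close> of the form at \<open>x - t y\<close>.\<close>
    define t where "t = x $ i / y i $ i"
    have Qx: "Q *\<^sub>v x \<in> carrier_vec N" using Q x by simp
    have "y i \<bullet> (Q *\<^sub>v x) = (Q *\<^sub>v y i) \<bullet> x"
      using transpose_vec_mult_scalar[OF Q(2) x y(1)[of i]] sym by simp
    then have cross: "y i \<bullet> (Q *\<^sub>v x) = x $ i" using y x i by simp
    have Qd: "Q *\<^sub>v (x - t \<cdot>\<^sub>v y i) = Q *\<^sub>v x - t \<cdot>\<^sub>v unit_vec N i"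
      using Q x y by (simp add: mult_minus_distrib_mat_vec[of _ N N] mult_mat_vec[of _ N N])
    have "0 \<le> (x - t \<cdot>\<^sub>v y i) \<bullet> (Q *\<^sub>v (x - t \<cdot>\<^sub>v y i))"
      using nonneg x y by simp
    also have "\<dots> = x \<bullet> (Q *\<^sub>v x) - 2 * t * x $ i + t\<^sup>2 * y i $ i"
      unfolding Qd using x y(1)[of i] Qx i cross
      by (simp add: minus_scalar_prod_distrib[of _ N] scalar_prod_minus_distrib[of _ N]
          algebra_simps power2_eq_square)
    also have "\<dots> = x \<bullet> (Q *\<^sub>v x) - (x $ i)\<^sup>2 / y i $ i"
      using pos by (simp add: t_def field_simps power2_eq_square)
    finally show "(x $ i)\<^sup>2 \<le> x \<bullet> (Q *\<^sub>v x) * y i $ i"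
      using pos by (simp add: field_simps)
  qed
  \<comment> \<open>The summand 1 keeps \<open>s\<close> positive for \<open>N = 0\<close>.\<close>
  define s where "s = 1 + (\<Sum>i<N. y i $ i)"
  have "0 \<le> (\<Sum>i<N. y i $ i)"
    by (intro sum_nonneg less_imp_le yi[OF zero_carrier_vec]) simp
  then have s: "0 < s" by (simp add: s_def)
  have "1 / s * (x \<bullet> x) \<le> x \<bullet> (Q *\<^sub>v x)" if x: "x \<in> carrier_vec N" for x
  proof -
    have "x \<bullet> x = (\<Sum>i<N. (x $ i)\<^sup>2)"
      using x by (simp add: scalar_prod_def atLeast0LessThan power2_eq_square)
    also have "\<dots> \<le> (\<Sum>i<N. x \<bullet> (Q *\<^sub>v x) * y i $ i)"
      by (intro sum_mono coord x) simp
    also have "\<dots> \<le> x \<bullet> (Q *\<^sub>v x) * s"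
      using nonneg[OF x] by (simp add: s_def sum_distrib_left[symmetric] distrib_left)
    finally show ?thesis using s by (simp add: field_simps)
  qed
  with s show ?thesis by (intro exI[of _ "1 / s"]) simp
qed

text \<open>
  A symmetric positive definite matrix without positive off-diagonal entries is a nonsingular
  M-matrix, so it maps some positive vector to a positive vector. The witness solves
  \<open>Q *\<^sub>v x = (1, \<dots>, 1)\<close>. Writing \<open>z\<close> for the negative part of \<open>x\<close>, the vectors \<open>z\<close> and \<open>x + z\<close> are
  non-negative with disjoint supports, so the sign pattern gives \<open>z \<bullet> (Q *\<^sub>v (x + z)) \<le> 0\<close>; hence
  \<open>z \<bullet> (Q *\<^sub>v z) \<le> - (z \<bullet> (Q *\<^sub>v x)) \<le> 0\<close>, which forces \<open>z = 0\<close>.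
\<close>

lemma pos_def_Z_matrix_pos_vec:
  assumes Q: "pos_def Q" "Q \<in> carrier_mat N N"
    and off: "\<And>i j. i < N \<Longrightarrow> j < N \<Longrightarrow> i \<noteq> j \<Longrightarrow> Q $$ (i, j) \<le> 0"
  obtains x where "x \<in> carrier_vec N" "\<And>i. i < N \<Longrightarrow> 0 < x $ i"
    "\<And>i. i < N \<Longrightarrow> 0 < (Q *\<^sub>v x) $ i"
proof -
  obtain x where x: "x \<in> carrier_vec N" "Q *\<^sub>v x = vec N (\<lambda>_. 1)"
    using pos_def_solve[OF Q, of "vec N (\<lambda>_. 1)"] by auto
  define z where "z = vec N (\<lambda>i. max 0 (- x $ i))"
  have z: "z \<in> carrier_vec N" by (simp add: z_def)
  have "z \<bullet> (Q *\<^sub>v (x + z)) = (\<Sum>i<N. \<Sum>j<N. z $ i * Q $$ (i, j) * (x $ j + z $ j))"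
    using Q x z
    by (simp add: scalar_prod_def atLeast0LessThan sum_distrib_left mult.assoc)
  also have "\<dots> \<le> 0"
  proof (intro sum_nonpos)
    fix i j assume ij: "i \<in> {..<N}" "j \<in> {..<N}"
    show "z $ i * Q $$ (i, j) * (x $ j + z $ j) \<le> 0"
    proof (cases "i = j")
      case True
      then show ?thesis using ij by (auto simp: z_def max_def)
    next
      case False
      then have "Q $$ (i, j) * (x $ j + z $ j) \<le> 0"
        using off[of i j] ij by (intro mult_nonpos_nonneg) (auto simp: z_def)
      moreover have "0 \<le> z $ i" using ij by (simp add: z_def)
      ultimately show ?thesis by (simp add: mult.assoc mult_nonneg_nonpos)
    qed
  qed
  also have "z \<bullet> (Q *\<^sub>v (x + z)) = z \<bullet> (Q *\<^sub>v x) + z \<bullet> (Q *\<^sub>v z)"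
    using Q x(1) z by (simp add: mult_add_distrib_mat_vec[of _ N N] scalar_prod_add_distrib[of _ N])
  finally have "z \<bullet> (Q *\<^sub>v z) \<le> - (z \<bullet> (Q *\<^sub>v x))" by simp
  also have "\<dots> \<le> 0"
    unfolding x(2) using z by (auto simp: scalar_prod_def z_def intro!: sum_nonneg)
  finally have z0: "z = 0\<^sub>v N" using Q z by (fastforce simp: pos_def_def)
  have nonneg: "0 \<le> x $ i" if "i < N" for i
  proof -
    have "z $ i = 0" using z0 that by simp
    then show ?thesis using that by (simp add: z_def max_def split: if_splits)
  qed
  \<comment> \<open>A zero coordinate of \<open>x \<ge> 0\<close> would make that coordinate of \<open>Q *\<^sub>v x\<close> non-positive.\<close>
  have "0 < x $ i" if i: "i < N" for i
  proof (rule ccontr)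
    assume "\<not> 0 < x $ i"
    with nonneg[OF i] have xi: "x $ i = 0" by simp
    have "(Q *\<^sub>v x) $ i = (\<Sum>j<N. Q $$ (i, j) * x $ j)"
      using Q x(1) i by (simp add: scalar_prod_def atLeast0LessThan)
    also have "\<dots> \<le> 0"
    proof (intro sum_nonpos)
      fix j assume "j \<in> {..<N}"
      then show "Q $$ (i, j) * x $ j \<le> 0"
        using off[of i j] i nonneg[of j] xi
        by (cases "i = j") (auto intro!: mult_nonpos_nonneg)
    qed
    finally show False using x(2) i by simp
  qed
  with x show thesis by (intro that[of x]) auto
qed

section \<open>Quadratic forms with diagonal terms\<close>

lemma mat_diag_mult_vec:
  fixes x :: "real vec"
  assumes "x \<in> carrier_vec N"
  shows "mat_diag N t *\<^sub>v x = vec N (\<lambda>i. t i * x $ i)"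
proof (intro eq_vecI)
  fix i assume "i < dim_vec (vec N (\<lambda>i. t i * x $ i))"
  then have i: "i < N" by simp
  have "(mat_diag N t *\<^sub>v x) $ i = (\<Sum>j\<in>{0..<N}. (if i = j then t j else 0) * x $ j)"
    using assms i by (simp add: scalar_prod_def mat_diag_def)
  also have "\<dots> = (\<Sum>j\<in>{0..<N}. if i = j then t j * x $ j else 0)"
    by (intro sum.cong) auto
  finally show "(mat_diag N t *\<^sub>v x) $ i = vec N (\<lambda>i. t i * x $ i) $ i" using i by simp
qed (simp add: mat_diag_def)

lemma diagonal_mat_eq_mat_diag:
  assumes "T \<in> carrier_mat N N" "diagonal_mat T"
  shows "T = mat_diag N (\<lambda>i. T $$ (i, i))"
  using assms by (intro eq_matI) (auto simp: mat_diag_def diagonal_mat_def)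

lemma quadratic_form_add_diag:
  fixes A :: "real mat"
  assumes "A \<in> carrier_mat N N" "x \<in> carrier_vec N"
  shows "x \<bullet> ((A + mat_diag N t) *\<^sub>v x) = x \<bullet> (A *\<^sub>v x) + (\<Sum>i<N. t i * (x $ i)\<^sup>2)"
proof -
  have "(A + mat_diag N t) *\<^sub>v x = A *\<^sub>v x + vec N (\<lambda>i. t i * x $ i)"
    using assms by (simp add: add_mult_distrib_mat_vec[of _ N N] mat_diag_mult_vec)
  moreover have "x \<bullet> vec N (\<lambda>i. t i * x $ i) = (\<Sum>i<N. t i * (x $ i)\<^sup>2)"
    by (simp add: scalar_prod_def atLeast0LessThan power2_eq_square mult.left_commute)
  ultimately show ?thesis
    using assms by (simp add: scalar_prod_add_distrib[of _ N])
qed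

lemma symmetric_add_diag_iff:
  assumes A: "A \<in> carrier_mat N N"
  shows "transpose_mat (A + mat_diag N t) = A + mat_diag N t \<longleftrightarrow> transpose_mat A = (A :: real mat)"
proof -
  have "transpose_mat (A + mat_diag N t) = transpose_mat A + mat_diag N t"
    using A by (intro eq_matI) (auto simp: mat_diag_def)
  moreover have "transpose_mat A = A" if "transpose_mat A + mat_diag N t = A + mat_diag N t"
  proof (intro eq_matI)
    fix i j assume ij: "i < dim_row A" "j < dim_col A"
    have "(transpose_mat A + mat_diag N t) $$ (i, j) = (A + mat_diag N t) $$ (i, j)"
      using that by simp
    then show "transpose_mat A $$ (i, j) = A $$ (i, j)" using A ij by (simp add: mat_diag_def)
  qed (use A in auto)
  ultimately show ?thesis by auto
qed

lemma quadratic_form_congruence_diag: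
  fixes D :: "real mat"
  assumes D: "D \<in> carrier_mat N n" and x: "x \<in> carrier_vec N"
  shows "x \<bullet> (D * mat_diag n s * transpose_mat D *\<^sub>v x) = (\<Sum>j<n. s j * (\<Sum>i<N. D $$ (i, j) * x $ i)\<^sup>2)"
proof -
  let ?y = "transpose_mat D *\<^sub>v x"
  have y: "?y \<in> carrier_vec n" using D x by simp
  have S: "mat_diag n s \<in> carrier_mat n n" by simp
  have "D * mat_diag n s * transpose_mat D *\<^sub>v x = D *\<^sub>v (mat_diag n s *\<^sub>v ?y)"
    using D x S y by (simp add: assoc_mult_mat_vec[of _ N n _ n] assoc_mult_mat_vec[of _ N n _ N])
  then have "x \<bullet> (D * mat_diag n s * transpose_mat D *\<^sub>v x) = ?y \<bullet> (mat_diag n s *\<^sub>v ?y)"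
    using transpose_vec_mult_scalar[OF D mult_mat_vec_carrier[OF S y] x] by simp
  also have "\<dots> = (\<Sum>j<n. s j * (?y $ j)\<^sup>2)"
    unfolding mat_diag_mult_vec[OF y]
    by (simp add: scalar_prod_def atLeast0LessThan power2_eq_square mult.left_commute)
  also have "\<dots> = (\<Sum>j<n. s j * (\<Sum>i<N. D $$ (i, j) * x $ i)\<^sup>2)"
    using D x by (intro sum.cong) (auto simp: scalar_prod_def atLeast0LessThan)
  finally show ?thesis .
qed

section \<open>Schur complements of diagonal blocks\<close>

text \<open>
  Schur complement for a diagonal lower right block: for fixed \<open>x\<close> the form of the block matrix
  at \<open>x @\<^sub>v y\<close> is maximal at \<open>y\<^sub>k = (C x)\<^sub>k / v\<^sub>k\<close>, with value the left-hand side of the inequality.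
  Definiteness of that complement is stated with a margin \<open>\<epsilon>\<close>, which can then be shared out.
\<close>

lemma neg_def_block_diag_iff:
  assumes A: "A \<in> carrier_mat N N" and C: "C \<in> carrier_mat K N"
  shows "four_block_mat A (transpose_mat C) C (- mat_diag K v) \<prec>\<^sub>m 0\<^sub>m (N + K) (N + K) \<longleftrightarrow>
    transpose_mat A = A \<and> (\<forall>k<K. 0 < v k) \<and>
    (\<exists>\<epsilon>>0. \<forall>x\<in>carrier_vec N. x \<bullet> (A *\<^sub>v x) + (\<Sum>k<K. ((C *\<^sub>v x) $ k)\<^sup>2 / v k) \<le> - \<epsilon> * (x \<bullet> x))"
    (is "?B \<prec>\<^sub>m _ \<longleftrightarrow> _ \<and> _ \<and> ?R")
proof -
  have Ct: "transpose_mat C \<in> carrier_mat N K" using C by simp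
  have V: "- mat_diag K v \<in> carrier_mat K K" by simp
  have B: "?B \<in> carrier_mat (N + K) (N + K)" using A C by simp
  have "transpose_mat ?B = four_block_mat (transpose_mat A) (transpose_mat C) C (- mat_diag K v)"
  proof -
    have "transpose_mat (- mat_diag K v) = - mat_diag K v"
      by (intro eq_matI) (auto simp: mat_diag_def)
    then show ?thesis using transpose_four_block_mat[OF A Ct C V] by simp
  qed
  moreover have "A' = A" if "four_block_mat A' (transpose_mat C) C (- mat_diag K v) = ?B" "A' \<in> carrier_mat N N" for A'
  proof (intro eq_matI)
    fix i j assume "i < dim_row A" "j < dim_col A"
    then have "i < N" "j < N" using A by auto
    moreover have "four_block_mat A' (transpose_mat C) C (- mat_diag K v) $$ (i, j) = ?B $$ (i, j)"
      using that by simp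
    ultimately show "A' $$ (i, j) = A $$ (i, j)" using A that(2) by simp
  qed (use A that in auto)
  ultimately have sym: "transpose_mat ?B = ?B \<longleftrightarrow> transpose_mat A = A"
    using A by (metis transpose_carrier_mat)
  have form: "(x @\<^sub>v y) \<bullet> (?B *\<^sub>v (x @\<^sub>v y))
      = x \<bullet> (A *\<^sub>v x) + (\<Sum>k<K. 2 * (C *\<^sub>v x) $ k * y $ k - v k * (y $ k)\<^sup>2)"
    if x: "x \<in> carrier_vec N" and y: "y \<in> carrier_vec K" for x y
  proof -
    have "(x @\<^sub>v y) \<bullet> (?B *\<^sub>v (x @\<^sub>v y))
        = x \<bullet> (A *\<^sub>v x + transpose_mat C *\<^sub>v y) + y \<bullet> (C *\<^sub>v x + - mat_diag K v *\<^sub>v y)"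
      unfolding four_block_mat_mult_vec[OF A Ct C V x y]
      using A C x y mult_mat_vec_carrier[OF V y]
      by (intro scalar_prod_append[of _ N _ K]) auto
    also have "x \<bullet> (A *\<^sub>v x + transpose_mat C *\<^sub>v y) = x \<bullet> (A *\<^sub>v x) + x \<bullet> (transpose_mat C *\<^sub>v y)"
      using A C x y by (intro scalar_prod_add_distrib[of _ N]) auto
    also have "x \<bullet> (transpose_mat C *\<^sub>v y) = (C *\<^sub>v x) \<bullet> y"
      using transpose_vec_mult_scalar[OF Ct y x] by simp
    also have "\<dots> = (\<Sum>k<K. (C *\<^sub>v x) $ k * y $ k)"
      using y by (simp add: scalar_prod_def atLeast0LessThan)
    also have "y \<bullet> (C *\<^sub>v x + - mat_diag K v *\<^sub>v y) = y \<bullet> (C *\<^sub>v x) + y \<bullet> (- mat_diag K v *\<^sub>v y)"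
      using C x y mult_mat_vec_carrier[OF V y]
      by (intro scalar_prod_add_distrib[of _ K]) auto
    also have "y \<bullet> (C *\<^sub>v x) = (\<Sum>k<K. (C *\<^sub>v x) $ k * y $ k)"
      using C by (simp add: scalar_prod_def atLeast0LessThan mult.commute)
    also have "- mat_diag K v *\<^sub>v y = vec K (\<lambda>k. - v k * y $ k)"
    proof -
      have "- mat_diag K v *\<^sub>v y = - (mat_diag K v *\<^sub>v y)"
        using y by (intro uminus_mult_mat_vec) (simp add: mat_diag_def)
      also have "\<dots> = vec K (\<lambda>k. - v k * y $ k)"
        unfolding mat_diag_mult_vec[OF y] by (intro eq_vecI) auto
      finally show ?thesis .
    qed
    also have "y \<bullet> vec K (\<lambda>k. - v k * y $ k) = - (\<Sum>k<K. v k * (y $ k)\<^sup>2)"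
      by (simp add: scalar_prod_def atLeast0LessThan power2_eq_square sum_negf[symmetric] mult.left_commute)
    finally show ?thesis by (simp add: sum_subtractf sum.distrib sum_distrib_left mult.assoc)
  qed
  have zero: "z \<bullet> (0\<^sub>m (N + K) (N + K) *\<^sub>v z) = (0::real)" if "z \<in> carrier_vec (N + K)" for z
  proof -
    have "0\<^sub>m (N + K) (N + K) *\<^sub>v z = 0\<^sub>v (N + K)" using that by (intro eq_vecI) auto
    then show ?thesis using that by simp
  qed
  have neg: "?B \<prec>\<^sub>m 0\<^sub>m (N + K) (N + K) \<longleftrightarrow> transpose_mat A = A \<and>
      (\<forall>z \<in> carrier_vec (N + K). z \<noteq> 0\<^sub>v (N + K) \<longrightarrow> z \<bullet> (?B *\<^sub>v z) < 0)"
    unfolding loewner_less_iff[OF B zero_carrier_mat] sym by (simp add: zero)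
  show ?thesis
  proof
    assume L: "?B \<prec>\<^sub>m 0\<^sub>m (N + K) (N + K)"
    \<comment> \<open>Test the block matrix on the coordinate vectors of the second block.\<close>
    have "0 < v k" if k: "k < K" for k
    proof -
      have "0\<^sub>v N @\<^sub>v unit_vec K k \<noteq> (0\<^sub>v (N + K) :: real vec)"
      proof
        assume "0\<^sub>v N @\<^sub>v unit_vec K k = (0\<^sub>v (N + K) :: real vec)"
        then have "(0\<^sub>v N @\<^sub>v unit_vec K k) $ (N + k) = (0\<^sub>v (N + K) :: real vec) $ (N + k)" by simp
        then show False using k by simp
      qed
      then have "(0\<^sub>v N @\<^sub>v unit_vec K k) \<bullet> (?B *\<^sub>v (0\<^sub>v N @\<^sub>v unit_vec K k)) < 0"
        using L[unfolded neg] by auto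
      moreover have "0\<^sub>v N \<bullet> (A *\<^sub>v 0\<^sub>v N) = 0" using A by simp
      moreover have "(\<Sum>j<K. 2 * (C *\<^sub>v 0\<^sub>v N) $ j * unit_vec K k $ j - v j * (unit_vec K k $ j)\<^sup>2)
          = (\<Sum>j<K. if j = k then - v j else 0)"
        using C k by (intro sum.cong) (auto simp: unit_vec_def)
      ultimately show ?thesis using form[of "0\<^sub>v N" "unit_vec K k"] k by simp
    qed
    moreover have ?R
    proof -
      have "pos_def (- ?B)"
        using L A C by (auto simp: loewner_less_def minus_add_uminus_mat[of "0\<^sub>m (N + K) (N + K)" "N + K" "N + K"])
      then obtain \<epsilon> where \<epsilon>: "\<epsilon> > 0"
        "\<And>z. z \<in> carrier_vec (N + K) \<Longrightarrow> \<epsilon> * (z \<bullet> z) \<le> z \<bullet> (- ?B *\<^sub>v z)"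
        using pos_def_coercive[OF _ uminus_carrier_iff_mat[THEN iffD2, OF B]] by blast
      have "x \<bullet> (A *\<^sub>v x) + (\<Sum>k<K. ((C *\<^sub>v x) $ k)\<^sup>2 / v k) \<le> - \<epsilon> * (x \<bullet> x)"
        if x: "x \<in> carrier_vec N" for x
      proof -
        \<comment> \<open>The maximiser of the form for given \<open>x\<close>.\<close>
        define y where "y = vec K (\<lambda>k. (C *\<^sub>v x) $ k / v k)"
        have y: "y \<in> carrier_vec K" by (simp add: y_def)
        let ?z = "x @\<^sub>v y"
        have z: "?z \<in> carrier_vec (N + K)" using x y by simp
        have "(\<Sum>k<K. ((C *\<^sub>v x) $ k)\<^sup>2 / v k)
            = (\<Sum>k<K. 2 * (C *\<^sub>v x) $ k * y $ k - v k * (y $ k)\<^sup>2)"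
          using \<open>\<And>k. k < K \<Longrightarrow> 0 < v k\<close>
          by (intro sum.cong) (force simp: y_def field_simps power2_eq_square)+
        then have "x \<bullet> (A *\<^sub>v x) + (\<Sum>k<K. ((C *\<^sub>v x) $ k)\<^sup>2 / v k) = ?z \<bullet> (?B *\<^sub>v ?z)"
          by (simp add: form[OF x y])
        also have "\<dots> = - (?z \<bullet> (- ?B *\<^sub>v ?z))"
        proof -
          have "- ?B *\<^sub>v ?z = - (?B *\<^sub>v ?z)" using A C x y 
            by (intro uminus_mult_mat_vec) (simp add: mat_diag_def)
          moreover have "?B *\<^sub>v ?z \<in> carrier_vec (N + K)" using B z by simp
          ultimately show ?thesis
            using carrier_vecD[OF z] by (simp only: scalar_prod_uminus_right carrier_vecD minus_minus)
        qed
        also have "\<dots> \<le> - \<epsilon> * (?z \<bullet> ?z)" using \<epsilon>(2)[OF z] by simp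
        also have "?z \<bullet> ?z = x \<bullet> x + y \<bullet> y" using x y by (intro scalar_prod_append)
        also have "- \<epsilon> * (x \<bullet> x + y \<bullet> y) \<le> - \<epsilon> * (x \<bullet> x)"
          using \<epsilon>(1) by (auto simp: scalar_prod_def intro!: mult_left_mono_neg sum_nonneg)
        finally show ?thesis .
      qed
      with \<epsilon>(1) show ?thesis by blast
    qed
    ultimately show "transpose_mat A = A \<and> (\<forall>k<K. 0 < v k) \<and> ?R" using L[unfolded neg] by blast
  next
    assume R: "transpose_mat A = A \<and> (\<forall>k<K. 0 < v k) \<and> ?R"
    then obtain \<epsilon> where \<epsilon>: "\<epsilon> > 0" "\<And>x. x \<in> carrier_vec N \<Longrightarrow>
        x \<bullet> (A *\<^sub>v x) + (\<Sum>k<K. ((C *\<^sub>v x) $ k)\<^sup>2 / v k) \<le> - \<epsilon> * (x \<bullet> x)" by blast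
    have v: "0 < v k" if "k < K" for k using R that by blast
    have "z \<bullet> (?B *\<^sub>v z) < 0" if z: "z \<in> carrier_vec (N + K)" "z \<noteq> 0\<^sub>v (N + K)" for z
    proof -
      define x y where "x = vec_first z N" and "y = vec_last z K"
      have x: "x \<in> carrier_vec N" and y: "y \<in> carrier_vec K" and zxy: "z = x @\<^sub>v y"
        using z by (simp_all add: x_def y_def)
      show ?thesis
      proof (cases "x = 0\<^sub>v N")
        case False
        have "0 < x \<bullet> x" using x False by (rule scalar_prod_self_pos)
        have "(\<Sum>k<K. 2 * (C *\<^sub>v x) $ k * y $ k - v k * (y $ k)\<^sup>2)
            \<le> (\<Sum>k<K. ((C *\<^sub>v x) $ k)\<^sup>2 / v k)"
        proof (intro sum_mono)
          fix k assume "k \<in> {..<K}"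
          then have k: "0 < v k" using v by simp
          have "0 \<le> ((C *\<^sub>v x) $ k - v k * y $ k)\<^sup>2 / v k" using k by simp
          also have "\<dots> = ((C *\<^sub>v x) $ k)\<^sup>2 / v k - (2 * (C *\<^sub>v x) $ k * y $ k - v k * (y $ k)\<^sup>2)"
            using k by (simp add: field_simps power2_eq_square)
          finally show "2 * (C *\<^sub>v x) $ k * y $ k - v k * (y $ k)\<^sup>2 \<le> ((C *\<^sub>v x) $ k)\<^sup>2 / v k"
            by simp
        qed
        then have "z \<bullet> (?B *\<^sub>v z) \<le> - \<epsilon> * (x \<bullet> x)"
          using \<epsilon>(2)[OF x] by (simp add: zxy form[OF x y])
        also have "\<dots> < 0" using \<epsilon>(1) \<open>0 < x \<bullet> x\<close> by simp
        finally show ?thesis .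
      next
        case True
        have "\<exists>k<K. y $ k \<noteq> 0"
        proof (rule ccontr)
          assume "\<not> ?thesis"
          then have "y = 0\<^sub>v K" using y by (intro eq_vecI) auto
          with True z zxy show False by auto
        qed
        then obtain k where k: "k < K" "y $ k \<noteq> 0" by blast
        have "0 < (\<Sum>k<K. v k * (y $ k)\<^sup>2)"
          using k v by (intro sum_pos2[of _ k]) (auto simp: less_imp_le)
        moreover have "z \<bullet> (?B *\<^sub>v z) = - (\<Sum>k<K. v k * (y $ k)\<^sup>2)"
          using A C by (simp add: zxy form[OF x y]) (simp add: True sum_negf)
        ultimately show ?thesis by simp
      qed
    qed
    with R show "?B \<prec>\<^sub>m 0\<^sub>m (N + K) (N + K)" unfolding neg by blast
  qed
qed

text \<open>
  When the border consists of \<open>K\<close> copies of the same block, the Schur complement collects the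
  reciprocals of the weights that belong to the same column of that block.
\<close>

lemma neg_def_repeated_block_iff:
  assumes A: "A \<in> carrier_mat N N" and C: "C \<in> carrier_mat n N"
    and U: "U = mat N (K * n) (\<lambda>(i, k). C $$ (k mod n, i))"
  shows "four_block_mat A U (transpose_mat U) (- mat_diag (K * n) (\<lambda>k. \<gamma> (k div n) (k mod n)))
      \<prec>\<^sub>m 0\<^sub>m (N + K * n) (N + K * n) \<longleftrightarrow>
    transpose_mat A = A \<and> (\<forall>i<K. \<forall>j<n. 0 < \<gamma> i j) \<and>
    (\<exists>\<epsilon>>0. \<forall>x\<in>carrier_vec N. x \<bullet> (A *\<^sub>v x) + (\<Sum>j<n. (\<Sum>i<K. 1 / \<gamma> i j) * ((C *\<^sub>v x) $ j)\<^sup>2)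
      \<le> - \<epsilon> * (x \<bullet> x))"
proof -
  have Ut: "transpose_mat U \<in> carrier_mat (K * n) N" by (simp add: U)
  have pos: "(\<forall>k<K * n. 0 < \<gamma> (k div n) (k mod n)) \<longleftrightarrow> (\<forall>i<K. \<forall>j<n. 0 < \<gamma> i j)"
  proof (intro iffI allI impI)
    fix i j assume *: "\<forall>k<K * n. 0 < \<gamma> (k div n) (k mod n)" and ij: "i < K" "j < n"
    have "i * n + j < Suc i * n" using ij by simp
    also have "\<dots> \<le> K * n" using ij by (intro mult_le_mono1) simp
    finally show "0 < \<gamma> i j" using * ij by fastforce
  next
    fix k assume *: "\<forall>i<K. \<forall>j<n. 0 < \<gamma> i j" and k: "k < K * n"
    then have "0 < n" by (cases n) auto
    then show "0 < \<gamma> (k div n) (k mod n)" using * k by (simp add: less_mult_imp_div_less)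
  qed
  have sum: "(\<Sum>k<K * n. ((transpose_mat U *\<^sub>v x) $ k)\<^sup>2 / \<gamma> (k div n) (k mod n))
      = (\<Sum>j<n. (\<Sum>i<K. 1 / \<gamma> i j) * ((C *\<^sub>v x) $ j)\<^sup>2)" if x: "x \<in> carrier_vec N" for x
  proof -
    have entry: "(transpose_mat U *\<^sub>v x) $ k = (C *\<^sub>v x) $ (k mod n)" if k: "k < K * n" for k
    proof -
      have "k mod n < n" using k by (cases n) auto
      then show ?thesis using k C x by (simp add: U scalar_prod_def)
    qed
    let ?f = "\<lambda>k. ((C *\<^sub>v x) $ (k mod n))\<^sup>2 / \<gamma> (k div n) (k mod n)"
    have "(\<Sum>k<K * n. ((transpose_mat U *\<^sub>v x) $ k)\<^sup>2 / \<gamma> (k div n) (k mod n)) = sum ?f {..<K * n}"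
      by (intro sum.cong) (auto simp: entry)
    also have "\<dots> = (\<Sum>i<K. sum ?f {i * n..<i * n + n})" by (rule sum.nat_group[symmetric])
    also have "\<dots> = (\<Sum>i<K. \<Sum>j<n. ((C *\<^sub>v x) $ j)\<^sup>2 / \<gamma> i j)"
    proof (rule sum.cong[OF refl])
      fix i
      have "sum ?f {i * n..<i * n + n} = (\<Sum>j<n. ?f (j + i * n))"
        using sum.shift_bounds_nat_ivl[of ?f 0 "i * n" n] by (simp add: add.commute atLeast0LessThan)
      also have "\<dots> = (\<Sum>j<n. ((C *\<^sub>v x) $ j)\<^sup>2 / \<gamma> i j)"
        by (intro sum.cong) auto
      finally show "sum ?f {i * n..<i * n + n} = (\<Sum>j<n. ((C *\<^sub>v x) $ j)\<^sup>2 / \<gamma> i j)" .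
    qed
    also have "\<dots> = (\<Sum>j<n. \<Sum>i<K. ((C *\<^sub>v x) $ j)\<^sup>2 / \<gamma> i j)" by (rule sum.swap)
    finally show ?thesis by (simp add: sum_distrib_right)
  qed
  show ?thesis
    using neg_def_block_diag_iff[OF A Ut, of "\<lambda>k. \<gamma> (k div n) (k mod n)"]
    by (simp add: pos sum)
qed

section \<open>Entrywise weights and diagonal multipliers\<close>

lemma weighted_Cauchy_Schwarz:
  fixes b g :: "'i \<Rightarrow> real"
  assumes g: "\<And>i. i \<in> I \<Longrightarrow> 0 < g i"
  shows "(\<Sum>i\<in>I. b i)\<^sup>2 \<le> (\<Sum>i\<in>I. 1 / g i) * (\<Sum>i\<in>I. g i * (b i)\<^sup>2)"
proof (cases "finite I \<and> I \<noteq> {}")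
  case True
  define h where "h = (\<Sum>i\<in>I. 1 / g i)"
  have h: "0 < h" unfolding h_def using True g by (intro sum_pos) auto
  \<comment> \<open>The weighted mean of the numbers \<open>g i * b i\<close> minimises the sum of squares below.\<close>
  define m where "m = sum b I / h"
  have "0 \<le> (\<Sum>i\<in>I. g i * (b i - m / g i)\<^sup>2)"
    using g by (intro sum_nonneg mult_nonneg_nonneg) (auto simp: less_imp_le)
  also have "\<dots> = (\<Sum>i\<in>I. g i * (b i)\<^sup>2 - 2 * m * b i + m\<^sup>2 * (1 / g i))"
    using g by (intro sum.cong) (force simp: field_simps power2_eq_square)+
  also have "\<dots> = (\<Sum>i\<in>I. g i * (b i)\<^sup>2) - 2 * m * sum b I + m\<^sup>2 * h"
    by (simp only: h_def sum.distrib sum_subtractf sum_distrib_left)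
  also have "\<dots> = (\<Sum>i\<in>I. g i * (b i)\<^sup>2) - (sum b I)\<^sup>2 / h"
    using h by (simp add: m_def field_simps power2_eq_square)
  finally show ?thesis using h by (simp add: h_def[symmetric] field_simps)
qed auto

text \<open>
  The choice \<open>\<gamma> i j = S j * y j / (D i j * x i)\<close> with \<open>y j = (\<Sum>k<N. D k j * x k)\<close> makes the
  reciprocals over \<open>i\<close> sum to \<open>1 / S j\<close> (to \<open>0\<close> if \<open>N = 0\<close>) and turns \<open>\<Sum>j<n. \<gamma> i j * (D i j)\<^sup>2\<close> into
  \<open>\<Sum>j<n. D i j * S j * y j / x i\<close>, which the hypothesis bounds. It needs positive \<open>D i j\<close>; as the
  hypothesis is a finite set of strict inequalities, it survives adding a small \<open>\<epsilon>\<close> to every entry.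
\<close>

lemma exists_pos_weights:
  fixes D :: "nat \<Rightarrow> nat \<Rightarrow> real" and S T x :: "nat \<Rightarrow> real"
  assumes D: "\<And>i j. i < N \<Longrightarrow> j < n \<Longrightarrow> 0 \<le> D i j"
    and S: "\<And>j. j < n \<Longrightarrow> 0 < S j" and x: "\<And>i. i < N \<Longrightarrow> 0 < x i"
    and less: "\<And>i. i < N \<Longrightarrow> (\<Sum>j<n. D i j * S j * (\<Sum>k<N. D k j * x k)) < T i * x i"
  obtains \<gamma> where "\<And>i j. i < N \<Longrightarrow> j < n \<Longrightarrow> 0 < \<gamma> i j"
    "\<And>j. j < n \<Longrightarrow> (\<Sum>i<N. 1 / \<gamma> i j) \<le> 1 / S j"
    "\<And>i. i < N \<Longrightarrow> (\<Sum>j<n. \<gamma> i j * (D i j)\<^sup>2) \<le> T i"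
proof -
  have "\<forall>\<^sub>F \<epsilon> in at_right 0. (\<Sum>j<n. (D i j + \<epsilon>) * S j * (\<Sum>k<N. (D k j + \<epsilon>) * x k)) < T i * x i"
    if i: "i < N" for i
  proof (rule order_tendstoD(2))
    show "((\<lambda>\<epsilon>. \<Sum>j<n. (D i j + \<epsilon>) * S j * (\<Sum>k<N. (D k j + \<epsilon>) * x k)) \<longlongrightarrow>
        (\<Sum>j<n. (D i j + 0) * S j * (\<Sum>k<N. (D k j + 0) * x k))) (at_right 0)"
      by (intro tendsto_intros)
  qed (use less[OF i] in simp)
  then have "\<forall>\<^sub>F \<epsilon> in at_right 0. \<forall>i\<in>{..<N}.
      (\<Sum>j<n. (D i j + \<epsilon>) * S j * (\<Sum>k<N. (D k j + \<epsilon>) * x k)) < T i * x i"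
    by (intro eventually_ball_finite) auto
  then have "\<forall>\<^sub>F \<epsilon> in at_right 0. 0 < \<epsilon> \<and> (\<forall>i\<in>{..<N}.
      (\<Sum>j<n. (D i j + \<epsilon>) * S j * (\<Sum>k<N. (D k j + \<epsilon>) * x k)) < T i * x i)"
    by (intro eventually_conj eventually_at_right_less)
  from eventually_happens'[OF trivial_limit_at_right_real this]
  obtain \<epsilon> where \<epsilon>: "\<epsilon> > 0"
    "\<And>i. i < N \<Longrightarrow> (\<Sum>j<n. (D i j + \<epsilon>) * S j * (\<Sum>k<N. (D k j + \<epsilon>) * x k)) < T i * x i"
    by auto
  define E where "E i j = D i j + \<epsilon>" for i j
  define y where "y j = (\<Sum>k<N. E k j * x k)" for j
  define \<gamma> where "\<gamma> i j = S j * y j / (E i j * x i)" for i j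
  have E: "0 < E i j" if "i < N" "j < n" for i j
    using D[OF that] \<epsilon>(1) by (simp add: E_def)
  have y: "0 < y j" if "i < N" "j < n" for i j
    unfolding y_def using that E x by (intro sum_pos) auto
  show thesis
  proof
    show "0 < \<gamma> i j" if "i < N" "j < n" for i j
      using E[OF that] x that y[OF that] S by (simp add: \<gamma>_def)
    show "(\<Sum>i<N. 1 / \<gamma> i j) \<le> 1 / S j" if j: "j < n" for j
    proof (cases "N = 0")
      case True
      then show ?thesis using S[OF j] by simp
    next
      case False
      then have "0 < y j" using y[of 0] j by simp
      have "(\<Sum>i<N. 1 / \<gamma> i j) = (\<Sum>i<N. E i j * x i) / (S j * y j)"
        by (simp add: \<gamma>_def sum_divide_distrib)
      also have "\<dots> = 1 / S j" using \<open>0 < y j\<close> S[OF j] by (simp add: y_def[symmetric])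
      finally show ?thesis by simp
    qed
    show "(\<Sum>j<n. \<gamma> i j * (D i j)\<^sup>2) \<le> T i" if i: "i < N" for i
    proof -
      have "(\<Sum>j<n. \<gamma> i j * (D i j)\<^sup>2) \<le> (\<Sum>j<n. \<gamma> i j * (E i j)\<^sup>2)"
        using \<epsilon>(1) D i \<open>\<And>i j. i < N \<Longrightarrow> j < n \<Longrightarrow> 0 < \<gamma> i j\<close>
        by (intro sum_mono mult_left_mono power_mono) (auto simp: E_def less_imp_le)
      also have "\<dots> = (\<Sum>j<n. E i j * S j * y j) / x i"
        unfolding sum_divide_distrib
      proof (intro sum.cong refl)
        fix j assume "j \<in> {..<n}"
        then show "\<gamma> i j * (E i j)\<^sup>2 = E i j * S j * y j / x i"
          using E[of i j] x[of i] i by (simp add: \<gamma>_def field_simps power2_eq_square)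
      qed
      also have "\<dots> \<le> T i"
        using \<epsilon>(2)[OF i] x[OF i] by (simp add: E_def y_def field_simps)
      finally show ?thesis .
    qed
  qed
qed

text \<open>
  By the Schur complements, both sides concern the form
  \<open>x \<bullet> (A *\<^sub>v x) + (\<Sum>i<N. t i * (x $ i)\<^sup>2) + (\<Sum>j<n. c j * ((C *\<^sub>v x) $ j)\<^sup>2)\<close>: the weights \<open>\<gamma>\<close> allow
  \<open>t i = (\<Sum>j<n. \<gamma> i j * (D $$ (i, j))\<^sup>2)\<close> and \<open>c j = (\<Sum>i<N. 1 / \<gamma> i j)\<close>, while \<open>T\<close> and \<open>S\<close> allow
  \<open>t i = T $$ (i, i)\<close> and \<open>c j = 1 / S $$ (j, j)\<close>. Weighted Cauchy-Schwarz shows that weights give an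
  admissible pair \<open>T\<close>, \<open>S\<close> once \<open>T\<close> receives half of the margin. Conversely, since \<open>D\<close> is
  non-negative, \<open>T - D * S * transpose_mat D\<close> has no positive off-diagonal entry, and its positive
  vector yields weights that make both \<open>t\<close> and \<open>c\<close> no larger. The bound \<open>n \<le> N\<close> excludes \<open>N = 0 < n\<close>,
  where \<open>c\<close> would be an empty sum and have no reciprocal.
\<close>

lemma scaled_lmi_iff:
  fixes A C D U :: "real mat"
  assumes A: "A \<in> carrier_mat N N" and C: "C \<in> carrier_mat n N" and D: "D \<in> carrier_mat N n"
    and D_nonneg: "\<And>i j. i < N \<Longrightarrow> j < n \<Longrightarrow> 0 \<le> D $$ (i, j)"
    and N: "n \<le> N"
    and U: "U = mat N (N * n) (\<lambda>(i, k). C $$ (k mod n, i))"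
  shows "(\<exists>\<gamma>. (\<forall>i<N. \<forall>j<n. 0 < \<gamma> i j) \<and>
      four_block_mat (A + mat_diag N (\<lambda>i. \<Sum>j<n. \<gamma> i j * (D $$ (i, j))\<^sup>2)) U (transpose_mat U)
        (- mat_diag (N * n) (\<lambda>k. \<gamma> (k div n) (k mod n))) \<prec>\<^sub>m 0\<^sub>m (N + N * n) (N + N * n)) \<longleftrightarrow>
    (\<exists>T S. T \<in> carrier_mat N N \<and> diagonal_mat T \<and> S \<in> carrier_mat n n \<and> diagonal_mat S \<and>
      four_block_mat (A + T) (transpose_mat C) C (- S) \<prec>\<^sub>m 0\<^sub>m (N + n) (N + n) \<and>
      D * S * transpose_mat D \<prec>\<^sub>m T)"
    (is "(\<exists>\<gamma>. ?pos \<gamma> \<and> ?G \<gamma> \<prec>\<^sub>m ?zero) \<longleftrightarrow> ?R")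
proof -
  have diag: "mat_diag k t \<in> carrier_mat k k" "transpose_mat (mat_diag k t) = mat_diag k t"
    "diagonal_mat (mat_diag k t)" for k and t :: "nat \<Rightarrow> real"
    by (auto simp: mat_diag_def diagonal_mat_def)
  have diag_form: "x \<bullet> (mat_diag N t *\<^sub>v x) = (\<Sum>i<N. t i * (x $ i)\<^sup>2)"
    if "x \<in> carrier_vec N" for x :: "real vec" and t
    unfolding mat_diag_mult_vec[OF that]
    by (simp add: scalar_prod_def atLeast0LessThan power2_eq_square mult.left_commute)
  have norm: "x \<bullet> x = (\<Sum>i<N. (x $ i)\<^sup>2)" if "x \<in> carrier_vec N" for x :: "real vec"
    using that by (simp add: scalar_prod_def atLeast0LessThan power2_eq_square)
  have DSD: "D * mat_diag n s * transpose_mat D \<in> carrier_mat N N"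
    "transpose_mat (D * mat_diag n s * transpose_mat D) = D * mat_diag n s * transpose_mat D" for s
  proof -
    show "D * mat_diag n s * transpose_mat D \<in> carrier_mat N N"
      by (rule mult_carrier_mat[OF mult_carrier_mat[OF D diag(1)]]) (use D in simp)
    have "transpose_mat (D * mat_diag n s * transpose_mat D)
        = D * (transpose_mat (mat_diag n s) * transpose_mat D)"
      using D diag(1)[of n s] by (simp add: transpose_mult[of _ N n _ N] transpose_mult[of _ N n _ n])
    then show "transpose_mat (D * mat_diag n s * transpose_mat D) = D * mat_diag n s * transpose_mat D"
      using D diag[of n s] by (simp add: assoc_mult_mat[of _ N n _ n _ N])
  qed
  have less_iff: "D * mat_diag n s * transpose_mat D \<prec>\<^sub>m mat_diag N t \<longleftrightarrow>
      (\<forall>x \<in> carrier_vec N. x \<noteq> 0\<^sub>v N \<longrightarrow>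
        (\<Sum>j<n. s j * (\<Sum>i<N. D $$ (i, j) * x $ i)\<^sup>2) < (\<Sum>i<N. t i * (x $ i)\<^sup>2))" for s t
    unfolding loewner_less_iff[OF DSD(1) diag(1)]
    by (simp add: DSD(2) diag(2) quadratic_form_congruence_diag[OF D] diag_form)
  have G_iff: "?G \<gamma> \<prec>\<^sub>m ?zero \<longleftrightarrow> transpose_mat A = A \<and> ?pos \<gamma> \<and>
      (\<exists>\<epsilon>>0. \<forall>x\<in>carrier_vec N.
        x \<bullet> (A *\<^sub>v x) + (\<Sum>i<N. (\<Sum>j<n. \<gamma> i j * (D $$ (i, j))\<^sup>2) * (x $ i)\<^sup>2)
          + (\<Sum>j<n. (\<Sum>i<N. 1 / \<gamma> i j) * ((C *\<^sub>v x) $ j)\<^sup>2) \<le> - \<epsilon> * (x \<bullet> x))" for \<gamma>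
    using neg_def_repeated_block_iff[OF add_carrier_mat[OF diag(1)] C U, of A]
    by (simp add: symmetric_add_diag_iff[OF A] quadratic_form_add_diag[OF A])
  have TS_iff: "four_block_mat (A + mat_diag N t) (transpose_mat C) C (- mat_diag n s) \<prec>\<^sub>m 0\<^sub>m (N + n) (N + n) \<longleftrightarrow>
      transpose_mat A = A \<and> (\<forall>j<n. 0 < s j) \<and>
      (\<exists>\<epsilon>>0. \<forall>x\<in>carrier_vec N.
        x \<bullet> (A *\<^sub>v x) + (\<Sum>i<N. t i * (x $ i)\<^sup>2) + (\<Sum>j<n. ((C *\<^sub>v x) $ j)\<^sup>2 / s j) \<le> - \<epsilon> * (x \<bullet> x))" for t s
    using neg_def_block_diag_iff[OF add_carrier_mat[OF diag(1)] C, of A]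
    by (simp add: symmetric_add_diag_iff[OF A] quadratic_form_add_diag[OF A])
  show ?thesis
  proof
    assume "\<exists>\<gamma>. ?pos \<gamma> \<and> ?G \<gamma> \<prec>\<^sub>m ?zero"
    then obtain \<gamma> \<epsilon> where A_sym: "transpose_mat A = A" and \<gamma>: "?pos \<gamma>" and \<epsilon>: "0 < \<epsilon>"
      "\<And>x. x \<in> carrier_vec N \<Longrightarrow>
        x \<bullet> (A *\<^sub>v x) + (\<Sum>i<N. (\<Sum>j<n. \<gamma> i j * (D $$ (i, j))\<^sup>2) * (x $ i)\<^sup>2)
          + (\<Sum>j<n. (\<Sum>i<N. 1 / \<gamma> i j) * ((C *\<^sub>v x) $ j)\<^sup>2) \<le> - \<epsilon> * (x \<bullet> x)"
      unfolding G_iff by blast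
    \<comment> \<open>Half of the margin goes into \<open>t\<close>, which makes \<open>D * S * transpose_mat D \<prec>\<^sub>m T\<close> strict; the
      other half keeps the block matrix negative definite.\<close>
    define s where "s j = 1 / (\<Sum>i<N. 1 / \<gamma> i j)" for j
    define t where "t i = (\<Sum>j<n. \<gamma> i j * (D $$ (i, j))\<^sup>2) + \<epsilon> / 2" for i
    have harm: "0 < (\<Sum>i<N. 1 / \<gamma> i j)" if "j < n" for j
      using that \<gamma> N by (intro sum_pos) (auto simp: lessThan_empty_iff)
    have t_sum: "(\<Sum>i<N. t i * (x $ i)\<^sup>2)
        = (\<Sum>i<N. (\<Sum>j<n. \<gamma> i j * (D $$ (i, j))\<^sup>2) * (x $ i)\<^sup>2) + \<epsilon> / 2 * (x \<bullet> x)"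
      if "x \<in> carrier_vec N" for x
      using that by (simp add: t_def norm distrib_right sum.distrib sum_distrib_left)
    have "four_block_mat (A + mat_diag N t) (transpose_mat C) C (- mat_diag n s) \<prec>\<^sub>m 0\<^sub>m (N + n) (N + n)"
      unfolding TS_iff
    proof (intro conjI exI[of _ "\<epsilon> / 2"] allI impI ballI A_sym)
      fix x :: "real vec" assume x: "x \<in> carrier_vec N"
      show "x \<bullet> (A *\<^sub>v x) + (\<Sum>i<N. t i * (x $ i)\<^sup>2) + (\<Sum>j<n. ((C *\<^sub>v x) $ j)\<^sup>2 / s j) \<le> - (\<epsilon> / 2) * (x \<bullet> x)"
        using \<epsilon>(2)[OF x] by (simp add: t_sum[OF x] s_def mult.commute)
    qed (use \<epsilon>(1) harm in \<open>auto simp: s_def\<close>)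
    moreover have "D * mat_diag n s * transpose_mat D \<prec>\<^sub>m mat_diag N t"
      unfolding less_iff
    proof (intro ballI impI)
      fix x :: "real vec" assume x: "x \<in> carrier_vec N" "x \<noteq> 0\<^sub>v N"
      have "0 < x \<bullet> x" using x scalar_prod_self_pos by blast
      have "s j * (\<Sum>i<N. D $$ (i, j) * x $ i)\<^sup>2 \<le> (\<Sum>i<N. \<gamma> i j * (D $$ (i, j) * x $ i)\<^sup>2)"
        if j: "j < n" for j
      proof -
        have "(\<Sum>i<N. D $$ (i, j) * x $ i)\<^sup>2
            \<le> (\<Sum>i<N. 1 / \<gamma> i j) * (\<Sum>i<N. \<gamma> i j * (D $$ (i, j) * x $ i)\<^sup>2)"
          using \<gamma> j by (intro weighted_Cauchy_Schwarz) auto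
        then show ?thesis using harm[OF j] by (simp add: s_def field_simps)
      qed
      then have "(\<Sum>j<n. s j * (\<Sum>i<N. D $$ (i, j) * x $ i)\<^sup>2)
          \<le> (\<Sum>j<n. \<Sum>i<N. \<gamma> i j * (D $$ (i, j) * x $ i)\<^sup>2)"
        by (intro sum_mono) simp
      also have "\<dots> = (\<Sum>i<N. \<Sum>j<n. \<gamma> i j * (D $$ (i, j) * x $ i)\<^sup>2)" by (rule sum.swap)
      also have "\<dots> = (\<Sum>i<N. (\<Sum>j<n. \<gamma> i j * (D $$ (i, j))\<^sup>2) * (x $ i)\<^sup>2)"
        by (simp add: sum_distrib_right power_mult_distrib mult.assoc)
      also have "\<dots> < (\<Sum>i<N. t i * (x $ i)\<^sup>2)"
        using \<epsilon>(1) \<open>0 < x \<bullet> x\<close> by (simp add: t_sum[OF x(1)])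
      finally show "(\<Sum>j<n. s j * (\<Sum>i<N. D $$ (i, j) * x $ i)\<^sup>2) < (\<Sum>i<N. t i * (x $ i)\<^sup>2)" .
    qed
    ultimately show ?R using diag by blast
  next
    assume ?R
    then obtain T S where T: "T \<in> carrier_mat N N" "diagonal_mat T"
      and S: "S \<in> carrier_mat n n" "diagonal_mat S"
      and lmi: "four_block_mat (A + T) (transpose_mat C) C (- S) \<prec>\<^sub>m 0\<^sub>m (N + n) (N + n)"
      and less: "D * S * transpose_mat D \<prec>\<^sub>m T" by blast
    define t s where "t i = T $$ (i, i)" and "s j = S $$ (j, j)" for i j
    have Tt: "T = mat_diag N t" and Ss: "S = mat_diag n s"
      unfolding t_def s_def using T S diagonal_mat_eq_mat_diag by blast+
    obtain \<epsilon> where A_sym: "transpose_mat A = A" and s: "\<And>j. j < n \<Longrightarrow> 0 < s j" and \<epsilon>: "0 < \<epsilon>"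
      "\<And>x. x \<in> carrier_vec N \<Longrightarrow> x \<bullet> (A *\<^sub>v x) + (\<Sum>i<N. t i * (x $ i)\<^sup>2)
        + (\<Sum>j<n. ((C *\<^sub>v x) $ j)\<^sup>2 / s j) \<le> - \<epsilon> * (x \<bullet> x)"
      using lmi unfolding Tt Ss TS_iff by blast
    define Q where "Q = T - D * S * transpose_mat D"
    have Q: "Q \<in> carrier_mat N N" unfolding Q_def Ss using minus_carrier_mat[OF DSD(1)] .
    have Q_pos: "pos_def Q" using less by (simp add: loewner_less_def Q_def)
    have DSD_entry: "(D * S * transpose_mat D) $$ (i, k) = (\<Sum>j<n. D $$ (i, j) * s j * D $$ (k, j))"
      if "i < N" "k < N" for i k
      unfolding Ss mat_diag_mult_right[OF D]
      using D that by (simp add: scalar_prod_def atLeast0LessThan)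
    have "Q $$ (i, k) \<le> 0" if "i < N" "k < N" "i \<noteq> k" for i k
    proof -
      have "0 \<le> (\<Sum>j<n. D $$ (i, j) * s j * D $$ (k, j))"
        using that D_nonneg s by (intro sum_nonneg mult_nonneg_nonneg) (auto simp: less_imp_le)
      moreover have "Q $$ (i, k) = T $$ (i, k) - (D * S * transpose_mat D) $$ (i, k)"
        unfolding Q_def using that D by (intro index_minus_mat) auto
      ultimately show ?thesis using that T DSD_entry[OF that(1,2)] by (simp add: diagonal_mat_def)
    qed
    then obtain x where x: "x \<in> carrier_vec N" "\<And>i. i < N \<Longrightarrow> 0 < x $ i"
      "\<And>i. i < N \<Longrightarrow> 0 < (Q *\<^sub>v x) $ i"
      using pos_def_Z_matrix_pos_vec[OF Q_pos Q] by blast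
    have "(\<Sum>j<n. D $$ (i, j) * s j * (\<Sum>k<N. D $$ (k, j) * x $ k)) < t i * x $ i" if i: "i < N" for i
    proof -
      have DSDx: "(D * S * transpose_mat D *\<^sub>v x) $ i
          = (\<Sum>j<n. D $$ (i, j) * s j * (\<Sum>k<N. D $$ (k, j) * x $ k))"
      proof -
        have "(D * S * transpose_mat D *\<^sub>v x) $ i
            = (\<Sum>k<N. (\<Sum>j<n. D $$ (i, j) * s j * D $$ (k, j)) * x $ k)"
          using D x(1) i by (simp add: scalar_prod_def[of _ x] atLeast0LessThan DSD_entry del: index_mult_mat(1))
        also have "\<dots> = (\<Sum>j<n. D $$ (i, j) * s j * (\<Sum>k<N. D $$ (k, j) * x $ k))"
          unfolding sum_distrib_left sum_distrib_right by (subst sum.swap) (simp add: mult.assoc)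
        finally show ?thesis .
      qed
      have "Q *\<^sub>v x = T *\<^sub>v x - D * S * transpose_mat D *\<^sub>v x"
        unfolding Q_def using T D S x(1) by (intro minus_mult_distrib_mat_vec[of _ N N]) auto
      then have "(Q *\<^sub>v x) $ i = t i * x $ i - (D * S * transpose_mat D *\<^sub>v x) $ i"
        using i D x(1) by (simp add: Tt mat_diag_mult_vec)
      then show ?thesis using x(3)[OF i] by (simp add: DSDx)
    qed
    then obtain \<gamma> where \<gamma>: "\<And>i j. i < N \<Longrightarrow> j < n \<Longrightarrow> 0 < \<gamma> i j"
      "\<And>j. j < n \<Longrightarrow> (\<Sum>i<N. 1 / \<gamma> i j) \<le> 1 / s j"
      "\<And>i. i < N \<Longrightarrow> (\<Sum>j<n. \<gamma> i j * (D $$ (i, j))\<^sup>2) \<le> t i"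
      using exists_pos_weights[of N n "\<lambda>i j. D $$ (i, j)" s "\<lambda>i. x $ i" t] D_nonneg s x(2) by blast
    have "?G \<gamma> \<prec>\<^sub>m ?zero"
      unfolding G_iff
    proof (intro conjI exI[of _ \<epsilon>] ballI A_sym \<epsilon>(1))
      fix z :: "real vec" assume z: "z \<in> carrier_vec N"
      have "(\<Sum>i<N. (\<Sum>j<n. \<gamma> i j * (D $$ (i, j))\<^sup>2) * (z $ i)\<^sup>2) \<le> (\<Sum>i<N. t i * (z $ i)\<^sup>2)"
        using \<gamma>(3) by (intro sum_mono mult_right_mono) auto
      moreover have "(\<Sum>j<n. (\<Sum>i<N. 1 / \<gamma> i j) * ((C *\<^sub>v z) $ j)\<^sup>2) \<le> (\<Sum>j<n. ((C *\<^sub>v z) $ j)\<^sup>2 / s j)"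
      proof (intro sum_mono)
        fix j assume "j \<in> {..<n}"
        then show "(\<Sum>i<N. 1 / \<gamma> i j) * ((C *\<^sub>v z) $ j)\<^sup>2 \<le> ((C *\<^sub>v z) $ j)\<^sup>2 / s j"
          using mult_right_mono[OF \<gamma>(2), of j "((C *\<^sub>v z) $ j)\<^sup>2"] by simp
      qed
      ultimately show "z \<bullet> (A *\<^sub>v z) + (\<Sum>i<N. (\<Sum>j<n. \<gamma> i j * (D $$ (i, j))\<^sup>2) * (z $ i)\<^sup>2)
          + (\<Sum>j<n. (\<Sum>i<N. 1 / \<gamma> i j) * ((C *\<^sub>v z) $ j)\<^sup>2) \<le> - \<epsilon> * (z \<bullet> z)"
        using \<epsilon>(2)[OF z] by linarith
    qed (use \<gamma>(1) in auto)
    with \<gamma>(1) show "\<exists>\<gamma>. ?pos \<gamma> \<and> ?G \<gamma> \<prec>\<^sub>m ?zero" by blast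
  qed
qed

section \<open>The uncertain closed loop\<close>

lemma index_foldr_append_cols_replicate:
  assumes "E \<in> carrier_mat N n"
  shows "foldr (@\<^sub>c) (replicate K E) (0\<^sub>m N 0) = mat N (K * n) (\<lambda>(i, k). E $$ (i, k mod n))"
proof (induction K)
  case (Suc K)
  have "foldr (@\<^sub>c) (replicate (Suc K) E) (0\<^sub>m N 0) = E @\<^sub>c mat N (K * n) (\<lambda>(i, k). E $$ (i, k mod n))"
    using Suc by simp
  also have "\<dots> = mat N (Suc K * n) (\<lambda>(i, k). E $$ (i, k mod n))"
    using assms by (intro eq_matI) (auto simp: append_cols_def mod_if[of _ n] le_mod_geq)
  finally show ?case .
qed (use assms in auto)

lemma sum_of_mats_outer_unit_eq_diag:
  fixes g :: "nat \<Rightarrow> nat \<Rightarrow> real"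
  shows "sum_of_mats N N (\<lambda>(i, j). g i j \<cdot>\<^sub>m outer_prod (unit_vec N i) (unit_vec N i)) ({..<N} \<times> {..<n})
    = mat_diag N (\<lambda>i. \<Sum>j<n. g i j)"
proof (intro eq_matI)
  fix r c assume "r < dim_row (mat_diag N (\<lambda>i. \<Sum>j<n. g i j))" "c < dim_col (mat_diag N (\<lambda>i. \<Sum>j<n. g i j))"
  then have rc: "r < N" "c < N" by (auto simp: mat_diag_def)
  have "sum_of_mats N N (\<lambda>(i, j). g i j \<cdot>\<^sub>m outer_prod (unit_vec N i) (unit_vec N i)) ({..<N} \<times> {..<n}) $$ (r, c)
      = (\<Sum>i<N. \<Sum>j<n. (g i j \<cdot>\<^sub>m outer_prod (unit_vec N i) (unit_vec N i)) $$ (r, c))"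
    using rc by (simp add: sum_of_mats_def sum.cartesian_product case_prod_unfold)
  also have "\<dots> = (\<Sum>i<N. if i = r then (if r = c then \<Sum>j<n. g r j else 0) else 0)"
    using rc by (intro sum.cong) (auto simp: outer_prod_def unit_vec_def)
  also have "\<dots> = mat_diag N (\<lambda>i. \<Sum>j<n. g i j) $$ (r, c)"
    using rc by (simp add: mat_diag_def)
  finally show "sum_of_mats N N (\<lambda>(i, j). g i j \<cdot>\<^sub>m outer_prod (unit_vec N i) (unit_vec N i)) ({..<N} \<times> {..<n}) $$ (r, c)
      = mat_diag N (\<lambda>i. \<Sum>j<n. g i j) $$ (r, c)" .
qed (auto simp: sum_of_mats_def mat_diag_def)

text \<open>
  The value at \<open>lo\<close> separates infimum and supremum, since the interval contains \<open>lo\<close> and the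
  entries of its members are bounded by those of \<open>lo\<close> and \<open>hi\<close>.
\<close>

lemma INF_le_SUP_interval_mult:
  fixes lo hi F :: "real mat"
  assumes lo: "lo \<in> carrier_mat n m" and hi: "hi \<in> carrier_mat n m" "lo \<le> hi"
    and F: "F \<in> carrier_mat m k" and ij: "i < n" "j < k"
  shows "(INF B\<in>{lo..hi}. (B * F) $$ (i, j)) \<le> (SUP B\<in>{lo..hi}. (B * F) $$ (i, j))"
proof -
  define c where "c = (\<Sum>r<m. (\<bar>lo $$ (i, r)\<bar> + \<bar>hi $$ (i, r)\<bar>) * \<bar>F $$ (r, j)\<bar>)"
  have bound: "\<bar>(B * F) $$ (i, j)\<bar> \<le> c"
    if "B \<in> {lo..hi}" for B
  proof -
    have le: "lo \<le> B" "B \<le> hi" using that by simp_all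
    have B: "B \<in> carrier_mat n m"
      using le(1) carrier_matD[OF lo] by (metis carrier_matI less_eq_mat_def)
    have entries: "lo $$ (i, r) \<le> B $$ (i, r) \<and> B $$ (i, r) \<le> hi $$ (i, r)" if "r < m" for r
      using le that ij(1) carrier_matD[OF B] carrier_matD[OF hi(1)] unfolding less_eq_mat_def
      by metis
    have "\<bar>(B * F) $$ (i, j)\<bar> = \<bar>\<Sum>r<m. B $$ (i, r) * F $$ (r, j)\<bar>"
      using B F ij by (simp add: scalar_prod_def atLeast0LessThan)
    also have "\<dots> \<le> (\<Sum>r<m. \<bar>B $$ (i, r)\<bar> * \<bar>F $$ (r, j)\<bar>)"
      using sum_abs[of "\<lambda>r. B $$ (i, r) * F $$ (r, j)" "{..<m}"] by (simp add: abs_mult)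
    also have "\<dots> \<le> (\<Sum>r<m. (\<bar>lo $$ (i, r)\<bar> + \<bar>hi $$ (i, r)\<bar>) * \<bar>F $$ (r, j)\<bar>)"
    proof (intro sum_mono mult_right_mono)
      fix r assume "r \<in> {..<m}"
      then show "\<bar>B $$ (i, r)\<bar> \<le> \<bar>lo $$ (i, r)\<bar> + \<bar>hi $$ (i, r)\<bar>" using entries[of r] by auto
    qed simp
    finally show ?thesis by (simp add: c_def)
  qed
  have "lo \<in> {lo..hi}" using hi by simp
  moreover have "bdd_below ((\<lambda>B. (B * F) $$ (i, j)) ` {lo..hi})"
    using bound by (intro bdd_belowI2[of _ "- c"]) (simp add: abs_le_iff minus_le_iff)
  moreover have "bdd_above ((\<lambda>B. (B * F) $$ (i, j)) ` {lo..hi})"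
    using bound by (intro bdd_aboveI2[of _ _ c]) (simp add: abs_le_iff)
  ultimately show ?thesis by (meson cINF_lower cSUP_upper order_trans)
qed

theorem proposition2:
  fixes n m l n\<phi> nh :: nat
    and width :: "nat \<Rightarrow> nat"
    and \<phi> :: "real \<Rightarrow> real"
    and W :: "nat \<Rightarrow> real mat" and b v_star :: "nat \<Rightarrow> real vec"
    and Ad_lo Ad_hi Bd_lo Bd_hi A0 Ar BN_lo BN_hi B0 Br D RV R\<phi> \<Psi> :: "real mat"
    and M X :: "real vec \<Rightarrow> real mat"
    and Z :: "real vec \<Rightarrow> real mat \<Rightarrow> real mat"
    and U :: "real mat \<Rightarrow> real mat"
    and V :: "(nat \<Rightarrow> nat \<Rightarrow> real) \<Rightarrow> real mat"
    and vbar1 \<alpha> \<beta> :: "real vec"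
  assumes layers: "l \<ge> 1" "width 0 = n" "width (l + 1) = m"
    and weights: "\<And>i. i \<in> {1..l + 1} \<Longrightarrow> W i \<in> carrier_mat (width i) (width (i - 1))"
    and biases: "\<And>i. i \<in> {1..l + 1} \<Longrightarrow> b i \<in> carrier_vec (width i)"
    and equilibrium: "network \<phi> W b l (0\<^sub>v n) = 0\<^sub>v m"
    and v_star: "v_star = layer_in \<phi> W b (0\<^sub>v n)"
    and n\<phi>: "n\<phi> = (\<Sum>i=1..l. width i)"
    and nh: "nh = 2 * n + n\<phi>"
    and Ad: "Ad_lo \<in> carrier_mat n n" "Ad_hi \<in> carrier_mat n n" "Ad_lo \<le> Ad_hi"
    and Bd: "Bd_lo \<in> carrier_mat n m" "Bd_hi \<in> carrier_mat n m" "Bd_lo \<le> Bd_hi"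
    and vbar1: "vbar1 \<in> carrier_vec (width 1)"
    and sector: "\<alpha> \<in> carrier_vec n\<phi>" "\<beta> \<in> carrier_vec n\<phi>" "\<alpha> \<le> \<beta>"
    and RV: "RV = four_block_mat (1\<^sub>m n) (0\<^sub>m n n\<phi>) (0\<^sub>m m n) (N_uw width W l)"
    and R\<phi>: "R\<phi> = four_block_mat (N_vx width W l) (N_vw width W l) (0\<^sub>m n\<phi> n) (1\<^sub>m n\<phi>)"
    and \<Psi>: "\<Psi> = four_block_mat (diag_of_vec \<beta>) (- 1\<^sub>m n\<phi>) (- diag_of_vec \<alpha>) (1\<^sub>m n\<phi>)"
    and M: "\<And>lam. M lam =
      four_block_mat (0\<^sub>m n\<phi> n\<phi>) (diag_of_vec lam) (diag_of_vec lam) (0\<^sub>m n\<phi> n\<phi>)"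
    and X: "\<And>lam. X lam = transpose_mat R\<phi> * transpose_mat \<Psi> * M lam * \<Psi> * R\<phi>"
    and A0: "A0 = (1 / 2) \<cdot>\<^sub>m (Ad_hi + Ad_lo)"
    and Ar: "Ar = (1 / 2) \<cdot>\<^sub>m (Ad_hi - Ad_lo)"
    and BN_lo: "BN_lo = mat n n\<phi> (\<lambda>ij. INF Bd\<in>{Bd_lo..Bd_hi}. (Bd * N_uw width W l) $$ ij)"
    and BN_hi: "BN_hi = mat n n\<phi> (\<lambda>ij. SUP Bd\<in>{Bd_lo..Bd_hi}. (Bd * N_uw width W l) $$ ij)"
    and B0: "B0 = (1 / 2) \<cdot>\<^sub>m (BN_hi + BN_lo)"
    and Br: "Br = (1 / 2) \<cdot>\<^sub>m (BN_hi - BN_lo)"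
    and D: "D = transpose_mat (Ar @\<^sub>c Br @\<^sub>c 0\<^sub>m n n)"
    and Z: "\<And>lam P. Z lam P = four_block_mat
        (- (transpose_mat RV * (1\<^sub>m n @\<^sub>r 0\<^sub>m m n) * P * (1\<^sub>m n @\<^sub>c 0\<^sub>m n m) * RV) + X lam)
        (transpose_mat (P * (A0 @\<^sub>c B0)))
        (P * (A0 @\<^sub>c B0))
        (- P)"
    and U: "\<And>P. U P = foldr (@\<^sub>c) (replicate nh (0\<^sub>m (n + n\<phi>) n @\<^sub>r P)) (0\<^sub>m nh 0)"
    and V: "\<And>\<gamma>. V \<gamma> = mat_diag (nh * n) (\<lambda>k. \<gamma> (k div n) (k mod n))"
  shows "(\<exists>P lam \<gamma>.
            P \<in> carrier_mat n n \<and> 0\<^sub>m n n \<prec>\<^sub>m P \<and>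
            lam \<in> carrier_vec n\<phi> \<and> 0\<^sub>v n\<phi> \<le> lam \<and>
            (\<forall>i<nh. \<forall>j<n. \<gamma> i j > 0) \<and>
            four_block_mat
              (Z lam P + sum_of_mats nh nh
                 (\<lambda>(i, j). (\<gamma> i j * (D $$ (i, j))\<^sup>2) \<cdot>\<^sub>m outer_prod (unit_vec nh i) (unit_vec nh i))
                 ({..<nh} \<times> {..<n}))
              (U P)
              (transpose_mat (U P))
              (- V \<gamma>)
            \<prec>\<^sub>m 0\<^sub>m (nh + nh * n) (nh + nh * n) \<and>
            (\<forall>i<width 1.
               0\<^sub>m (1 + n) (1 + n) \<preceq>\<^sub>m
               four_block_mat
                 (mat 1 1 (\<lambda>_. (vbar1 $ i - v_star 1 $ i)\<^sup>2))
                 (mat_of_row (row (W 1) i))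
                 (transpose_mat (mat_of_row (row (W 1) i)))
                 P))
     \<longleftrightarrow>
         (\<exists>P lam T S.
            P \<in> carrier_mat n n \<and> 0\<^sub>m n n \<prec>\<^sub>m P \<and>
            lam \<in> carrier_vec n\<phi> \<and> 0\<^sub>v n\<phi> \<le> lam \<and>
            T \<in> carrier_mat nh nh \<and> diagonal_mat T \<and>
            S \<in> carrier_mat n n \<and> diagonal_mat S \<and>
            four_block_mat
              (Z lam P + T)
              (transpose_mat (0\<^sub>m n (n + n\<phi>) @\<^sub>c P))
              (0\<^sub>m n (n + n\<phi>) @\<^sub>c P)
              (- S)
            \<prec>\<^sub>m 0\<^sub>m (nh + n) (nh + n) \<and>
            D * S * transpose_mat D \<prec>\<^sub>m T \<and>
            (\<forall>i<width 1.
               0\<^sub>m (1 + n) (1 + n) \<preceq>\<^sub>m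
               four_block_mat
                 (mat 1 1 (\<lambda>_. (vbar1 $ i - v_star 1 $ i)\<^sup>2))
                 (mat_of_row (row (W 1) i))
                 (transpose_mat (mat_of_row (row (W 1) i)))
                 P))"
    (is "(\<exists>P lam \<gamma>. ?P P \<and> ?pos P \<and> ?L lam \<and> ?nonneg lam \<and> ?\<gamma> \<gamma> \<and> ?lmi_a P lam \<gamma> \<and> ?ell P) \<longleftrightarrow>
      (\<exists>P lam T S. _ P \<and> _ P \<and> _ lam \<and> _ lam \<and> ?T T \<and> ?dT T \<and> ?S S \<and> ?dS S \<and>
        ?lmi_b P lam T S \<and> ?less T S \<and> _ P)")
proof -
  let ?C = "\<lambda>P. 0\<^sub>m n (n + n\<phi>) @\<^sub>c P"
  have W1: "W 1 \<in> carrier_mat (width 1) (width 0)" using weights[of 1] layers by simp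
  have Nuw: "N_uw width W l \<in> carrier_mat m n\<phi>"
    using N_uw_carrier[OF layers(1), of W width] weights[of "l + 1"] layers by (simp add: n\<phi>)
  have Nvx: "N_vx width W l \<in> carrier_mat n\<phi> n"
    using N_vx_carrier[of l W width, OF layers(1) W1] layers by (simp add: n\<phi>)
  have Ar_c: "Ar \<in> carrier_mat n n" and Br_c: "Br \<in> carrier_mat n n\<phi>"
    using Ad by (auto simp: Ar Br BN_lo BN_hi)
  have nh_eq: "nh = n + n\<phi> + n" by (simp add: nh)
  have D_c: "D \<in> carrier_mat nh n"
    unfolding D transpose_carrier_mat
    using append_cols_carrier[OF Ar_c append_cols_carrier[OF Br_c zero_carrier_mat[of n n]]]
    by (simp add: nh_eq add.assoc)
  have D_nonneg: "0 \<le> D $$ (i, j)" if ij: "i < nh" "j < n" for i j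
  proof -
    have "0 \<le> Ar $$ (j, i)" if "i < n"
      using Ad ij that by (auto simp: Ar less_eq_mat_def)
    moreover have "0 \<le> Br $$ (j, k)" if "k < n\<phi>" for k
      using INF_le_SUP_interval_mult[OF Bd Nuw ij(2) that] ij that by (simp add: Br BN_lo BN_hi)
    ultimately show ?thesis
      using ij Ar_c Br_c by (auto simp: D append_cols_def nh)
  qed
  \<comment> \<open>For each \<open>P\<close> and \<open>lam\<close> separately, the conditions on the multipliers are equivalent; all other
    conditions are common to both sides.\<close>
  have key: "(\<exists>\<gamma>. ?\<gamma> \<gamma> \<and> ?lmi_a P lam \<gamma>) \<longleftrightarrow>
      (\<exists>T S. ?T T \<and> ?dT T \<and> ?S S \<and> ?dS S \<and> ?lmi_b P lam T S \<and> ?less T S)"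
    if P: "P \<in> carrier_mat n n" "0\<^sub>m n n \<prec>\<^sub>m P" for P lam
  proof -
    have P_sym: "P $$ (i, j) = P $$ (j, i)" if "i < n" "j < n" for i j
    proof -
      have "transpose_mat P = P" using P by (simp add: loewner_less_def)
      then show ?thesis using that P(1) by (metis carrier_matD index_transpose_mat(1))
    qed
    have C_c: "?C P \<in> carrier_mat n nh"
      using append_cols_carrier[OF zero_carrier_mat P(1), of "n + n\<phi>"] by (simp add: nh_eq)
    have Z_c: "Z lam P \<in> carrier_mat nh nh"
      unfolding Z using P(1) Nvx by (intro carrier_matI) (simp_all add: X R\<phi> nh)
    have E_c: "0\<^sub>m (n + n\<phi>) n @\<^sub>r P \<in> carrier_mat nh n"
      using carrier_append_rows[OF zero_carrier_mat P(1), of "n + n\<phi>"] by (simp add: nh_eq)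
    \<comment> \<open>Symmetry of \<open>P\<close> makes the repeated block of \<open>U P\<close> the transpose of \<open>?C P\<close>.\<close>
    have U_eq: "U P = mat nh (nh * n) (\<lambda>(i, k). ?C P $$ (k mod n, i))"
      unfolding U index_foldr_append_cols_replicate[OF E_c]
    proof (intro cong_mat refl)
      fix i k assume ik: "i < nh" "k < nh * n"
      then have "k mod n < n" by (cases n) auto
      then show "(case (i, k) of (i, k) \<Rightarrow> (0\<^sub>m (n + n\<phi>) n @\<^sub>r P) $$ (i, k mod n))
          = (case (i, k) of (i, k) \<Rightarrow> ?C P $$ (k mod n, i))"
        using ik P(1) P_sym by (auto simp: append_rows_def append_cols_def nh)
    qed
    show ?thesis
      unfolding V sum_of_mats_outer_unit_eq_diag
      by (rule scaled_lmi_iff[OF Z_c C_c D_c D_nonneg _ U_eq]) (auto simp: nh)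
  qed
  show ?thesis
  proof (rule iffI; elim exE conjE)
    fix P lam \<gamma>
    assume P: "?P P" "?pos P" and rest: "?L lam" "?nonneg lam" "?ell P"
      and "?\<gamma> \<gamma>" "?lmi_a P lam \<gamma>"
    then have "\<exists>\<gamma>. ?\<gamma> \<gamma> \<and> ?lmi_a P lam \<gamma>" by (intro exI conjI)
    from key[OF P, THEN iffD1, OF this]
    obtain T S where "?T T" "?dT T" "?S S" "?dS S" "?lmi_b P lam T S" "?less T S"
      by (elim exE conjE)
    with P rest show "\<exists>P lam T S. ?P P \<and> ?pos P \<and> ?L lam \<and> ?nonneg lam \<and> ?T T \<and> ?dT T \<and>
        ?S S \<and> ?dS S \<and> ?lmi_b P lam T S \<and> ?less T S \<and> ?ell P"
      by (intro exI conjI)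
  next
    fix P lam T S
    assume P: "?P P" "?pos P" and rest: "?L lam" "?nonneg lam" "?ell P"
      and "?T T" "?dT T" "?S S" "?dS S" "?lmi_b P lam T S" "?less T S"
    then have "\<exists>T S. ?T T \<and> ?dT T \<and> ?S S \<and> ?dS S \<and> ?lmi_b P lam T S \<and> ?less T S"
      by (intro exI conjI)
    from key[OF P, THEN iffD2, OF this] obtain \<gamma> where "?\<gamma> \<gamma>" "?lmi_a P lam \<gamma>"
      by (elim exE conjE)
    with P rest show "\<exists>P lam \<gamma>. ?P P \<and> ?pos P \<and> ?L lam \<and> ?nonneg lam \<and> ?\<gamma> \<gamma> \<and>
        ?lmi_a P lam \<gamma> \<and> ?ell P"
      by (intro exI conjI)
  qed
qed

end
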